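(* For $d\ge 2$, let $G$ be an infinite connected graph of maximum degree $d$. Then $$\frac{(d-1)^{d-1}}{d^d}\le p_h(G)\le p_\star(d),$$ where $p_\star(d)=\lim_{n\to\infty}p_h\big(\mathscr S^d_{(1,\dots,1,n)}\big)$. Moreover $p_\star(2)=p_\star(3)=1/4$, and for $d\ge4$, $p_\star(d)$ is the unique solution $p$ in $(0,1/4]$ of the equation $$\tfrac12(1-p)^{d-1}\big(1+\sqrt{1-4p}\big)=p .$$
   Context: All graphs are simple. For $\mathbf n=(n_1,\dots,n_d)\in\{1,2,\dots\}^d$, $\mathscr S^d_{\mathbf n}$ is the finite star graph with a distinguished vertex $v_0$ and $d$ rays of lengths $n_1,\dots,n_d$: its vertices are $v_0$ and $v_{ij}$ ($1\le i\le d$, $1\le j\le n_i$), and its edges are $v_0v_{i1}$ and $v_{ij}v_{i,j+1}$. Thus $\mathscr S^d_{(1,\dots,1,n)}$ has $d-1$ rays of length $1$ and one ray of length $n$. For a simple graph $G=(V,E)$, a process indexed by $V$ is $1$-dependent if its restrictions to two subsets of $V$ are independent whenever these subsets are at graph distance larger than $1$ from each other. A hard-core process on $G$ is a process $J=(J_v)_{v\in V}\in\{0,1\}^V$ such that almost surely we do not have $J_u=J_v=1$ whenever $u,v$ are neighbors. The critical point of $G$ is $$p_h(G)=\sup\{p:\ \text{there exists a 1-dependent hard-core process } J \text{ on } G \text{ with } \mathbb P(J_v=1)=p\ \ \forall v\in V\}.$$ *)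

theory Defs
  imports "HOL-Probability.Probability" "HOL-Library.Extended_Nat"
begin

section \<open>Simple graphs\<close>

text \<open>A graph is given by its vertex set \<open>V\<close> and its set \<open>E\<close> of edges, which are
  two-element sets of vertices.\<close>

definition simple_graph :: "'a set \<Rightarrow> 'a set set \<Rightarrow> bool" where
  "simple_graph V E \<longleftrightarrow> (\<forall>e\<in>E. \<exists>u v. u \<in> V \<and> v \<in> V \<and> u \<noteq> v \<and> e = {u, v})"

definition neighbors :: "'a set set \<Rightarrow> 'a \<Rightarrow> 'a set" where
  "neighbors E v = {u. {u, v} \<in> E}"

definition has_max_degree :: "'a set \<Rightarrow> 'a set set \<Rightarrow> nat \<Rightarrow> bool" where
  "has_max_degree V E d \<longleftrightarrow>
     (\<forall>v\<in>V. finite (neighbors E v) \<and> card (neighbors E v) \<le> d) \<and>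
     (\<exists>v\<in>V. card (neighbors E v) = d)"

definition adj_rel :: "'a set set \<Rightarrow> ('a \<times> 'a) set" where
  "adj_rel E = {(u, v). {u, v} \<in> E}"

definition connected_graph :: "'a set \<Rightarrow> 'a set set \<Rightarrow> bool" where
  "connected_graph V E \<longleftrightarrow> V \<noteq> {} \<and> (\<forall>u\<in>V. \<forall>v\<in>V. (u, v) \<in> (adj_rel E)\<^sup>*)"

text \<open>The distance is the least number of steps of a walk, and \<open>\<infinity>\<close> if there is no walk.\<close>

definition graph_dist :: "'a set set \<Rightarrow> 'a \<Rightarrow> 'a \<Rightarrow> enat" where
  "graph_dist E u v = (INF n\<in>{n. (u, v) \<in> adj_rel E ^^ n}. enat n)"

definition graph_set_dist :: "'a set set \<Rightarrow> 'a set \<Rightarrow> 'a set \<Rightarrow> enat" where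
  "graph_set_dist E A B = (INF u\<in>A. INF v\<in>B. graph_dist E u v)"


section \<open>One-dependent hard-core processes\<close>

definition binary_process :: "'a set \<Rightarrow> 'w measure \<Rightarrow> ('a \<Rightarrow> 'w \<Rightarrow> nat) \<Rightarrow> bool" where
  "binary_process V M J \<longleftrightarrow>
     prob_space M \<and> (\<forall>v\<in>V. J v \<in> measurable M (count_space {0, 1}))"

definition restr_process :: "('a \<Rightarrow> 'w \<Rightarrow> nat) \<Rightarrow> 'a set \<Rightarrow> 'w \<Rightarrow> 'a \<Rightarrow> nat" where
  "restr_process J A = (\<lambda>\<omega>. \<lambda>v\<in>A. J v \<omega>)"

abbreviation binary_space :: "'a set \<Rightarrow> ('a \<Rightarrow> nat) measure" where
  "binary_space A \<equiv> PiM A (\<lambda>_. count_space {0, 1})"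

definition one_dependent ::
    "'a set \<Rightarrow> 'a set set \<Rightarrow> 'w measure \<Rightarrow> ('a \<Rightarrow> 'w \<Rightarrow> nat) \<Rightarrow> bool" where
  "one_dependent V E M J \<longleftrightarrow>
     (\<forall>A B. A \<subseteq> V \<and> B \<subseteq> V \<and> graph_set_dist E A B > 1 \<longrightarrow>
        prob_space.indep_var M (binary_space A) (restr_process J A)
                               (binary_space B) (restr_process J B))"

definition hard_core :: "'a set \<Rightarrow> 'a set set \<Rightarrow> 'w measure \<Rightarrow> ('a \<Rightarrow> 'w \<Rightarrow> nat) \<Rightarrow> bool" where
  "hard_core V E M J \<longleftrightarrow>
     (AE \<omega> in M. \<forall>u\<in>V. \<forall>v\<in>V. {u, v} \<in> E \<longrightarrow> \<not> (J u \<omega> = 1 \<and> J v \<omega> = 1))"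

definition one_dep_hard_core_process ::
    "'a set \<Rightarrow> 'a set set \<Rightarrow> 'w measure \<Rightarrow> ('a \<Rightarrow> 'w \<Rightarrow> nat) \<Rightarrow> real \<Rightarrow> bool" where
  "one_dep_hard_core_process V E M J p \<longleftrightarrow>
     binary_process V M J \<and> one_dependent V E M J \<and> hard_core V E M J \<and>
     (\<forall>v\<in>V. measure M {\<omega> \<in> space M. J v \<omega> = 1} = p)"

text \<open>HOL cannot quantify existentially over the type of the probability space. Sample spaces
  of type \<open>'a \<Rightarrow> nat\<close> suffice: for countable \<open>V\<close>, a process on any other space can be replaced by
  the coordinate process under its law, as lemma \<open>one_dep_hard_core_process_canonical\<close> shows.
  (Every connected graph of finite maximum degree is countable.)\<close>

definition p_h :: "'a set \<Rightarrow> 'a set set \<Rightarrow> real" where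
  "p_h V E = Sup {p. \<exists>(M :: ('a \<Rightarrow> nat) measure) J. one_dep_hard_core_process V E M J p}"

lemma one_dep_hard_core_process_canonical:
  fixes M :: "'w measure" and V :: "'a set"
  assumes J: "one_dep_hard_core_process V E M J p" and V: "countable V"
  shows "one_dep_hard_core_process V E
           (distr M (binary_space V) (restr_process J V)) (\<lambda>v x. x v) p"
proof -
  interpret prob_space M
    using J by (simp add: one_dep_hard_core_process_def binary_process_def)
  let ?X = "restr_process J V"
  let ?N = "distr M (binary_space V) ?X"
  have meas: "J v \<in> measurable M (count_space {0, 1})" if "v \<in> V" for v
    using J that by (simp add: one_dep_hard_core_process_def binary_process_def)
  have X: "restr_process J A \<in> measurable M (binary_space A)" if "A \<subseteq> V" for A
    unfolding restr_process_def using that meas by (intro measurable_restrict) auto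
  interpret N: prob_space ?N
    by (rule prob_space_distr[OF X]) simp
  have coord: "(\<lambda>x. x v) \<in> measurable (binary_space V) (count_space {0, 1})" if "v \<in> V" for v
    using that by (rule measurable_component_singleton)
  have R: "restr_process (\<lambda>v x. x v) A \<in> measurable (binary_space V) (binary_space A)"
    if "A \<subseteq> V" for A
    unfolding restr_process_def using that coord by (intro measurable_restrict) auto
  have comp: "restr_process (\<lambda>v x. x v) A (?X \<omega>) = restr_process J A \<omega>" if "A \<subseteq> V" for A \<omega>
    using that by (auto simp: restr_process_def fun_eq_iff)
  have bin: "binary_process V ?N (\<lambda>v x. x v)"
    using N.prob_space_axioms coord by (simp add: binary_process_def)
  have "N.indep_var (binary_space A) (restr_process (\<lambda>v x. x v) A)
                    (binary_space B) (restr_process (\<lambda>v x. x v) B)"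
    if AB: "A \<subseteq> V" "B \<subseteq> V" "graph_set_dist E A B > 1" for A B
  proof -
    have "indep_var (binary_space A) (restr_process J A) (binary_space B) (restr_process J B)"
      using J AB by (simp add: one_dep_hard_core_process_def one_dependent_def)
    hence "distr M (binary_space A) (restr_process J A) \<Otimes>\<^sub>M
             distr M (binary_space B) (restr_process J B) =
           distr M (binary_space A \<Otimes>\<^sub>M binary_space B)
             (\<lambda>\<omega>. (restr_process J A \<omega>, restr_process J B \<omega>))"
      by (simp add: indep_var_distribution_eq)
    moreover have "(\<lambda>x. (restr_process (\<lambda>v x. x v) A x, restr_process (\<lambda>v x. x v) B x))
        \<in> measurable (binary_space V) (binary_space A \<Otimes>\<^sub>M binary_space B)"
      using R AB by (intro measurable_Pair) auto
    ultimately show ?thesis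
      using R[OF AB(1)] R[OF AB(2)] X[OF order_refl]
      by (simp add: N.indep_var_distribution_eq distr_distr o_def comp[OF AB(1)] comp[OF AB(2)]
               del: One_nat_def)
  qed
  hence dep: "one_dependent V E ?N (\<lambda>v x. x v)"
    by (simp add: one_dependent_def)
  have one: "Measurable.pred (binary_space V) (\<lambda>x. x u = 1)" if "u \<in> V" for u
    using that by measurable
  have "Measurable.pred (binary_space V)
      (\<lambda>x. {u, v} \<in> E \<longrightarrow> \<not> (x u = 1 \<and> x v = 1))" if "u \<in> V" "v \<in> V" for u v
    using one that by (intro pred_intros_logic) auto
  hence "Measurable.pred (binary_space V)
     (\<lambda>x. \<forall>u\<in>V. \<forall>v\<in>V. {u, v} \<in> E \<longrightarrow> \<not> (x u = 1 \<and> x v = 1))"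
    using V unfolding pred_def
    by (intro sets.sets_Collect_countable_All') auto
  hence hc: "hard_core V E ?N (\<lambda>v x. x v)"
    using J X[of V]
    by (simp add: one_dep_hard_core_process_def hard_core_def AE_distr_iff pred_def
          restr_process_def cong: conj_cong)
  have "measure ?N {x \<in> space ?N. x v = 1} = p" if v: "v \<in> V" for v
  proof -
    have "{x \<in> space (binary_space V). x v = 1} \<in> sets (binary_space V)"
      using v by measurable
    moreover have "?X -` {x \<in> space (binary_space V). x v = 1} \<inter> space M =
                   {\<omega> \<in> space M. J v \<omega> = 1}"
      using v measurable_space[OF X[of V]] by (auto simp: restr_process_def)
    ultimately show ?thesis
      using J v X[of V] by (simp add: one_dep_hard_core_process_def measure_distr)
  qed
  with bin dep hc show ?thesis
    by (simp add: one_dep_hard_core_process_def)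
qed


section \<open>Star graphs\<close>

text \<open>\<open>Ray i j\<close> stands for $v_{ij}$. The ray lengths \<open>n 1, \<dots>, n d\<close> are meant to be positive.\<close>

datatype star_vertex = Center | Ray nat nat

definition star_verts :: "nat \<Rightarrow> (nat \<Rightarrow> nat) \<Rightarrow> star_vertex set" where
  "star_verts d n = insert Center {Ray i j | i j. 1 \<le> i \<and> i \<le> d \<and> 1 \<le> j \<and> j \<le> n i}"

definition star_edges :: "nat \<Rightarrow> (nat \<Rightarrow> nat) \<Rightarrow> star_vertex set set" where
  "star_edges d n =
     {{Center, Ray i 1} | i. 1 \<le> i \<and> i \<le> d} \<union>
     {{Ray i j, Ray i (j + 1)} | i j. 1 \<le> i \<and> i \<le> d \<and> 1 \<le> j \<and> j + 1 \<le> n i}"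

lemma simple_graph_star:
  assumes "\<And>i. 1 \<le> i \<Longrightarrow> i \<le> d \<Longrightarrow> 1 \<le> n i"
  shows "simple_graph (star_verts d n) (star_edges d n)"
  unfolding simple_graph_def
proof
  fix e assume "e \<in> star_edges d n"
  then consider i where "1 \<le> i" "i \<le> d" "e = {Center, Ray i 1}"
    | i j where "1 \<le> i" "i \<le> d" "1 \<le> j" "j + 1 \<le> n i" "e = {Ray i j, Ray i (j + 1)}"
    unfolding star_edges_def by blast
  then show "\<exists>u v. u \<in> star_verts d n \<and> v \<in> star_verts d n \<and> u \<noteq> v \<and> e = {u, v}"
  proof cases
    case (1 i)
    then show ?thesis
      using assms[of i]
      by (intro exI[of _ Center] exI[of _ "Ray i 1"]) (simp add: star_verts_def)
  next
    case (2 i j)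
    then show ?thesis
      by (intro exI[of _ "Ray i j"] exI[of _ "Ray i (j + 1)"]) (simp add: star_verts_def)
  qed
qed

text \<open>The ray lengths $(1,\dots,1,n)$.\<close>

definition long_ray :: "nat \<Rightarrow> nat \<Rightarrow> nat \<Rightarrow> nat" where
  "long_ray d n = (\<lambda>i. if i = d then n else 1)"

definition p_h_star :: "nat \<Rightarrow> nat \<Rightarrow> real" where
  "p_h_star d n = p_h (star_verts d (long_ray d n)) (star_edges d (long_ray d n))"

definition p_star :: "nat \<Rightarrow> real" where
  "p_star d = lim (p_h_star d)"

end

theory Submission
  imports Defs
begin

text \<open>
  Write \<open>Z H\<close> for the independence polynomial of the subgraph induced by a finite set \<open>H\<close> of
  vertices, evaluated at \<open>- p\<close>. In a 1-dependent hard-core process with marginal \<open>p\<close> the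
  vertices of an independent set are occupied independently, so the law of the process is forced:
  all vertices of \<open>S\<close> are occupied with probability \<open>p ^ card S\<close> if \<open>S\<close> is independent and \<open>0\<close>
  otherwise. By inclusion-exclusion, \<open>Z H\<close> is then the probability that \<open>H\<close> is empty. This turns the
  critical point into a question about signs (Shearer's theorem). If every \<open>Z H\<close> is nonnegative,
  inclusion-exclusion defines consistent finite-dimensional laws, and Kolmogorov's extension
  theorem yields the process (\<open>p_h_ge\<close>). Conversely, if a process with marginal \<open>p\<close> exists and
  \<open>q < p\<close>, then deleting occupied vertices independently shows that every \<open>Z H\<close>, now at \<open>- q\<close>, is
  strictly positive (\<open>p_h_le\<close>).

  Positivity of \<open>Z\<close> follows by bounding the ratios \<open>Z H / Z (H - {v})\<close> from below. Removing \<open>v\<close>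
  gives \<open>Z H = Z (H - {v}) - p * Z (H - {v} - neighbors E v)\<close>, and removing the neighbours of \<open>v\<close>
  one at a time expresses the last term by ratios of smaller sets, in which those neighbours have
  lost the neighbour \<open>v\<close>. Lemma \<open>indep_poly_pos_if_exposed\<close> isolates this induction. In an
  infinite connected graph of maximum degree \<open>d\<close>, every finite nonempty set has a vertex with a
  neighbour outside; with the ratio bound \<open>1 - 1/d\<close> this gives the lower bound
  \<open>(d - 1) ^ (d - 1) / d ^ d\<close>. In a star whose rays have length one except for a long one, the
  induction starts at the tip of the long ray, and gives positivity as long as \<open>p \<le> 1/4\<close> and
  \<open>p \<le> critical_fun d p\<close>, where \<open>critical_fun d p\<close> is the expression in the theorem's equation.

  The condition on \<open>p\<close> is sharp in the limit of long rays. If all \<open>Z H\<close> are positive, then \<open>Z\<close> is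
  decreasing in \<open>H\<close>. Let a graph contain a centre with \<open>d - 1\<close> further neighbours and a path
  starting at the centre. Adding the path vertices one at a time, the ratio \<open>s\<close> of successive values
  of \<open>Z\<close> starts at \<open>1 - p / (1 - p) ^ (d - 1)\<close> or less, and the next ratio is at most \<open>1 - p / s\<close>. If
  \<open>p > 1/4\<close> this map has no fixed point; if \<open>p \<le> 1/4\<close> and \<open>critical_fun d p < p\<close>, the start is below its smaller
  fixed point. Either way the ratio drops by a fixed amount at each step, so the path cannot be long
  (\<open>long_ray_bound\<close>). Only inequalities enter, so the star may be any subgraph, not necessarily an
  induced one. The same lemma therefore bounds \<open>p_h\<close> of the long stars and of every infinite
  connected graph of maximum degree \<open>d\<close>: from a vertex of degree \<open>d\<close>, geodesics to far away vertices
  supply the long ray.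

  Finally, \<open>critical_fun d\<close> is decreasing on \<open>{0..1/4}\<close>. For \<open>d = 2\<close> and \<open>d = 3\<close> it is still at
  least \<open>1/4\<close> at \<open>1/4\<close>, so the threshold is \<open>1/4\<close>; for \<open>d \<ge> 4\<close> it is below \<open>1/4\<close> there, and the
  threshold is its only fixed point in that interval.\<close>

section \<open>The independence polynomial at a negative argument\<close>

definition independent_set :: "'a set set \<Rightarrow> 'a set \<Rightarrow> bool" where
  "independent_set E S \<longleftrightarrow> (\<forall>u\<in>S. \<forall>v\<in>S. {u, v} \<notin> E)"

text \<open>The independence polynomial of the subgraph induced by \<open>H\<close> (the partition function of the hard-core
  lattice gas), at the argument \<open>- p\<close>.\<close>

definition indep_poly :: "'a set set \<Rightarrow> real \<Rightarrow> 'a set \<Rightarrow> real" where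
  "indep_poly E p H = (\<Sum>S | S \<subseteq> H \<and> independent_set E S. (- p) ^ card S)"

lemma independent_set_insert:
  assumes "{v} \<notin> E"
  shows "independent_set E (insert v S) \<longleftrightarrow> independent_set E S \<and> S \<inter> neighbors E v = {}"
  using assms unfolding independent_set_def neighbors_def
  by (auto simp: insert_commute)

lemma indep_poly_empty [simp]: "indep_poly E p {} = 1"
proof -
  have "{S. S \<subseteq> {} \<and> independent_set E S} = {{}}"
    by (auto simp: independent_set_def)
  then show ?thesis by (simp add: indep_poly_def)
qed

text \<open>An independent subset of \<open>H\<close> either avoids \<open>v\<close>, or consists of \<open>v\<close> and an independent set that
  avoids \<open>v\<close> and its neighbours.\<close>

lemma indep_poly_remove:
  assumes fin: "finite H" and v: "v \<in> H" and loop: "{v} \<notin> E"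
  shows "indep_poly E p H =
    indep_poly E p (H - {v}) - p * indep_poly E p (H - {v} - neighbors E v)"
proof -
  let ?A = "{S. S \<subseteq> H - {v} \<and> independent_set E S}"
  let ?B = "{S. S \<subseteq> H - {v} - neighbors E v \<and> independent_set E S}"
  have split: "{S. S \<subseteq> H \<and> independent_set E S} = ?A \<union> insert v ` ?B"
  proof (intro equalityI subsetI)
    fix S assume "S \<in> {S. S \<subseteq> H \<and> independent_set E S}"
    then have S: "S \<subseteq> H" "independent_set E S" by auto
    show "S \<in> ?A \<union> insert v ` ?B"
    proof (cases "v \<in> S")
      case True
      then have "S = insert v (S - {v})" by auto
      moreover have "S - {v} \<in> ?B"
        using S independent_set_insert[OF loop, of "S - {v}"] True
        by (auto simp: insert_absorb)
      ultimately show ?thesis by blast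
    qed (use S in auto)
  next
    fix S assume "S \<in> ?A \<union> insert v ` ?B"
    then show "S \<in> {S. S \<subseteq> H \<and> independent_set E S}"
      using v by (auto simp: independent_set_insert[OF loop])
  qed
  have finA: "finite ?A" and finB: "finite ?B"
    using fin by (auto intro: finite_subset[OF _ finite_Pow_iff[THEN iffD2, OF fin]])
  have "inj_on (insert v) ?B"
    by (rule inj_onI) (blast dest: insert_ident[THEN iffD1, rotated 2])
  then have "(\<Sum>S\<in>insert v ` ?B. (- p) ^ card S) = (\<Sum>S\<in>?B. (- p) ^ card (insert v S))"
    by (simp add: sum.reindex)
  also have "\<dots> = (\<Sum>S\<in>?B. - p * (- p) ^ card S)"
  proof (rule sum.cong[OF refl])
    fix S assume "S \<in> ?B"
    then have "finite S" "v \<notin> S" using fin by (auto intro: finite_subset)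
    then show "(- p) ^ card (insert v S) = - p * (- p) ^ card S" by simp
  qed
  also have "\<dots> = - p * indep_poly E p (H - {v} - neighbors E v)"
    by (simp add: indep_poly_def sum_distrib_left)
  finally show ?thesis
    unfolding indep_poly_def split
    by (subst sum.union_disjoint) (use finA finB in auto)
qed

section \<open>Positivity by removing exposed vertices\<close>

text \<open>The induction shows \<open>\<rho> v * Z (H - {v}) \<le> Z H\<close> along with positivity, for every \<open>v\<close> that is exposed
  in \<open>H\<close> (the predicate \<open>ex\<close>). The neighbours of \<open>v\<close> are removed from \<open>H - {v}\<close> one at a time. By
  assumption \<open>nbr\<close> the absence of \<open>v\<close> exposes each of them, so the induction hypothesis bounds every
  one of these ratios from below, and \<open>weight\<close> says that the product of these bounds is large enough.
  
  In the applications a vertex is exposed if some neighbour, respectively its parent in a rooted tree,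
  is missing from \<open>H\<close>; the argument is the same for both.\<close>

lemma indep_poly_pos_if_exposed:
  fixes ex :: "'a set \<Rightarrow> 'a \<Rightarrow> bool" and \<rho> :: "'a \<Rightarrow> real"
  assumes loop: "\<And>v. {v} \<notin> E" and p: "0 \<le> p"
    and anti: "\<And>H H' v. ex H v \<Longrightarrow> H' \<subseteq> H \<Longrightarrow> ex H' v"
    and nbr: "\<And>H u v. ex H v \<Longrightarrow> v \<in> H \<Longrightarrow> u \<in> H \<Longrightarrow> {u, v} \<in> E \<Longrightarrow> ex (H - {v}) u"
    and exposed: "\<And>H. finite H \<Longrightarrow> H \<subseteq> V \<Longrightarrow> H \<noteq> {} \<Longrightarrow> \<exists>v\<in>H. ex H v"
    and \<rho>: "\<And>v. v \<in> V \<Longrightarrow> 0 < \<rho> v" "\<And>v. v \<in> V \<Longrightarrow> \<rho> v \<le> 1"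
    and weight: "\<And>H v. finite H \<Longrightarrow> H \<subseteq> V \<Longrightarrow> v \<in> H \<Longrightarrow> ex H v \<Longrightarrow>
       p \<le> (1 - \<rho> v) * (\<Prod>u\<in>neighbors E v \<inter> H. \<rho> u)"
    and H: "finite H" "H \<subseteq> V"
  shows "0 < indep_poly E p H"
proof -
  let ?Z = "indep_poly E p"
  have "0 < ?Z H \<and> (\<forall>v\<in>H. ex H v \<longrightarrow> \<rho> v * ?Z (H - {v}) \<le> ?Z H)"
    using H
  proof (induction "card H" arbitrary: H rule: less_induct)
    case less
    have IH: "0 < ?Z H' \<and> (\<forall>v\<in>H'. ex H' v \<longrightarrow> \<rho> v * ?Z (H' - {v}) \<le> ?Z H')" if "H' \<subset> H" for H'
    proof (rule less.hyps)
      show "card H' < card H" using less.prems that by (simp add: psubset_card_mono)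
      show "finite H'" "H' \<subseteq> V" using less.prems that by (auto intro: finite_subset)
    qed
    have IH_pos: "0 < ?Z H'" if "H' \<subset> H" for H'
      using IH[OF that] by blast
    have IH_ratio: "\<rho> v * ?Z (H' - {v}) \<le> ?Z H'" if "H' \<subset> H" "v \<in> H'" "ex H' v" for H' v
      using IH[OF that(1)] that(2,3) by blast
    have ratio: "\<rho> v * ?Z (H - {v}) \<le> ?Z H" if v: "v \<in> H" "ex H v" for v
    proof -
      let ?H = "H - {v}" and ?N = "neighbors E v \<inter> H"
      have vN: "v \<notin> ?N" using loop by (auto simp: neighbors_def)
      have "(\<Prod>u\<in>U. \<rho> u) * ?Z (?H - U) \<le> ?Z ?H" if "finite U" "U \<subseteq> ?N" for U
        using that
      proof (induction U rule: finite_induct)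
        case (insert u U)
        have u: "u \<in> H" "{u, v} \<in> E" "u \<noteq> v" using insert.prems vN by (auto simp: neighbors_def)
        have "ex (?H - U) u" by (rule anti[OF nbr[OF v(2,1) u(1,2)]]) auto
        then have "\<rho> u * ?Z (?H - U - {u}) \<le> ?Z (?H - U)"
          using v u insert.hyps by (intro IH_ratio) auto
        moreover have "U \<subseteq> V" using insert.prems less.prems(2) by auto
        then have "0 < prod \<rho> U" by (intro prod_pos) (use \<rho>(1) in blast)
        ultimately have "prod \<rho> U * (\<rho> u * ?Z (?H - U - {u})) \<le> prod \<rho> U * ?Z (?H - U)"
          by (intro mult_left_mono) auto
        also have "\<dots> \<le> ?Z ?H" using insert by auto
        also have "?H - U - {u} = ?H - insert u U" by blast
        finally show ?case
          using insert.hyps by (simp add: mult_ac)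
      qed simp
      from this[of ?N] have prod: "(\<Prod>u\<in>?N. \<rho> u) * ?Z (?H - ?N) \<le> ?Z ?H"
        using less.prems by auto
      have eq: "?H - ?N = ?H - neighbors E v" by auto
      have "p * ?Z (?H - ?N) \<le> (1 - \<rho> v) * (\<Prod>u\<in>?N. \<rho> u) * ?Z (?H - ?N)"
        using weight[OF less.prems v] IH_pos[of "?H - ?N"] v
        by (intro mult_right_mono) (auto intro: less_imp_le)
      also have "\<dots> = (1 - \<rho> v) * ((\<Prod>u\<in>?N. \<rho> u) * ?Z (?H - ?N))" by simp
      also have "\<dots> \<le> (1 - \<rho> v) * ?Z ?H"
        using prod \<rho>(2)[of v] v less.prems by (intro mult_left_mono) auto
      finally show ?thesis
        unfolding indep_poly_remove[OF less.prems(1) v(1) loop] eq by (simp add: algebra_simps)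
    qed
    have "0 < ?Z H"
    proof (cases "H = {}")
      case False
      then obtain v where v: "v \<in> H" "ex H v" using exposed less.prems by blast
      have "0 < \<rho> v * ?Z (H - {v})"
        using \<rho>(1)[of v] IH_pos[of "H - {v}"] v less.prems by (intro mult_pos_pos) blast+
      then show ?thesis using ratio[OF v] by linarith
    qed simp
    then show ?case using ratio by blast
  qed
  then show ?thesis by blast
qed

section \<open>Positivity bounds the length of a long ray\<close>

text \<open>By the recursion \<open>indep_poly_remove\<close>, adding a vertex subtracts a multiple of another value of the
  polynomial, which is positive.\<close>

lemma indep_poly_antimono:
  assumes loop: "\<And>v. {v} \<notin> E" and q: "0 \<le> q"
    and pos: "\<forall>H. finite H \<and> H \<subseteq> V \<longrightarrow> 0 < indep_poly E q H"
    and H: "finite H" "H \<subseteq> V" "K \<subseteq> H"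
  shows "indep_poly E q H \<le> indep_poly E q K"
proof -
  have "finite (H - K)" using H by auto
  have "indep_poly E q (K \<union> U) \<le> indep_poly E q K" if "finite U" "U \<subseteq> H - K" for U
    using that
  proof (induction U rule: finite_induct)
    case (insert u U)
    have fin: "finite (K \<union> U)" "K \<union> U \<subseteq> V" using insert H by (auto intro: finite_subset)
    have "K \<union> insert u U - {u} = K \<union> U" using insert by auto
    then have "indep_poly E q (K \<union> insert u U) =
        indep_poly E q (K \<union> U) - q * indep_poly E q (K \<union> U - neighbors E u)"
      using indep_poly_remove[of "K \<union> insert u U" u E q] fin loop by auto
    moreover have "0 \<le> q * indep_poly E q (K \<union> U - neighbors E u)"
      using q pos[rule_format, of "K \<union> U - neighbors E u"] fin
      by (intro mult_nonneg_nonneg) (auto intro: less_imp_le)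
    ultimately show ?case using insert by auto
  qed simp
  from this[of "H - K"] \<open>finite (H - K)\<close> H(3) show ?thesis
    by (simp add: Un_absorb1)
qed

text \<open>Each new vertex multiplies the value by at most \<open>1 - q\<close>, because deleting its neighbours from the
  set can only increase the subtracted term. Edges inside \<open>L\<close> therefore do no harm.\<close>

lemma indep_poly_le_power:
  assumes loop: "\<And>v. {v} \<notin> E" and q: "0 \<le> q"
    and pos: "\<forall>H. finite H \<and> H \<subseteq> V \<longrightarrow> 0 < indep_poly E q H"
    and L: "finite L" "L \<subseteq> V" and q1: "q \<le> 1"
  shows "indep_poly E q L \<le> (1 - q) ^ card L"
  using L
proof (induction L rule: finite_induct)
  case (insert v L)
  have "indep_poly E q (insert v L) = indep_poly E q L - q * indep_poly E q (L - neighbors E v)"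
    using indep_poly_remove[of "insert v L" v E q] insert loop by auto
  also have "\<dots> \<le> indep_poly E q L - q * indep_poly E q L"
    using indep_poly_antimono[OF loop q pos, of L "L - neighbors E v"] insert q
    by (intro diff_left_mono mult_left_mono) auto
  also have "\<dots> = (1 - q) * indep_poly E q L" by (simp add: algebra_simps)
  also have "\<dots> \<le> (1 - q) * (1 - q) ^ card L"
    using insert q1 by (intro mult_left_mono) auto
  finally show ?case using insert by simp
qed simp

text \<open>The sets \<open>F k\<close> consist of the leaves \<open>L\<close> and the first \<open>k\<close> vertices of the ray. With \<open>s\<close> the ratio of
  \<open>Z (F (k + 1))\<close> and \<open>Z (F k)\<close>, the next ratio is at most \<open>1 - q / s = s - (s\<^sup>2 - s + q) / s\<close>, hence
  at most \<open>s - \<epsilon>\<close> since \<open>s \<le> 1\<close>. As all ratios are positive and the first is at most \<open>1\<close>, there is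
  room for fewer than \<open>1 / \<epsilon>\<close> steps.\<close>

lemma long_ray_bound:
  fixes r :: "nat \<Rightarrow> 'a"
  assumes loop: "\<And>v. {v} \<notin> E" and q: "0 < q"
    and pos: "\<forall>H. finite H \<and> H \<subseteq> V \<longrightarrow> 0 < indep_poly E q H"
    and L: "finite L" "L \<subseteq> V" "\<And>u. u \<in> L \<Longrightarrow> {u, r 0} \<in> E"
    and r: "\<And>k. k \<le> n \<Longrightarrow> r k \<in> V - L" "inj_on r {..n}"
           "\<And>k. k < n \<Longrightarrow> {r k, r (Suc k)} \<in> E"
    and \<epsilon>: "0 < \<epsilon>" "\<And>s. 0 < s \<Longrightarrow> s \<le> 1 - q / (1 - q) ^ card L \<Longrightarrow> \<epsilon> \<le> s\<^sup>2 - s + q"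
  shows "real n * \<epsilon> < 1"
proof -
  let ?Z = "indep_poly E q"
  define F where "F k = L \<union> r ` {..<k}" for k
  define \<sigma> where "\<sigma> = 1 - q / (1 - q) ^ card L"
  have F: "finite (F k)" "F k \<subseteq> V" if "k \<le> Suc n" for k
    using L r(1) that unfolding F_def by force+
  have notin: "r k \<notin> F k" if "k \<le> n" for k
    using r(1)[OF that] that inj_onD[OF r(2)] unfolding F_def by force
  have step: "?Z (F (Suc k)) = ?Z (F k) - q * ?Z (F k - neighbors E (r k))" if "k \<le> n" for k
  proof -
    have "F (Suc k) = insert (r k) (F k)" by (auto simp: F_def lessThan_Suc)
    then show ?thesis
      using indep_poly_remove[of "F (Suc k)" "r k" E q] loop F[of "Suc k"] notin[OF that] that
      by simp
  qed
  have "0 < 1 - q"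
    using pos[rule_format, of "{r 0}"] r(1)[of 0] indep_poly_remove[of "{r 0}" "r 0" E q] loop by simp
  then have q1: "q < 1" by simp
  have Fpos: "0 < ?Z (F k)" if "k \<le> Suc n" for k using pos F that by blast
  have "\<sigma> \<le> 1" using q q1 by (simp add: \<sigma>_def)
  have "?Z (F (Suc k)) \<le> (\<sigma> - real k * \<epsilon>) * ?Z (F k)" if "k \<le> n" for k
    using that
  proof (induction k)
    case 0
    have "F 0 - neighbors E (r 0) = {}" using L(3) by (auto simp: F_def neighbors_def)
    then have "?Z (F 0 - neighbors E (r 0)) = 1" by (simp only: indep_poly_empty)
    then have "?Z (F (Suc 0)) = ?Z (F 0) - q" using step[of 0] by simp
    moreover have "?Z L \<le> (1 - q) ^ card L"
      using indep_poly_le_power[OF loop _ pos L(1,2)] q q1 by simp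
    then have "?Z L * (q / (1 - q) ^ card L) \<le> q"
      using q q1 by (simp add: divide_le_eq mult_ac)
    moreover have "F 0 = L" by (simp add: F_def)
    ultimately show ?case by (simp add: \<sigma>_def algebra_simps)
  next
    case (Suc k)
    let ?x = "?Z (F k)" and ?y = "?Z (F (Suc k))" and ?z = "?Z (F (Suc (Suc k)))"
    have x: "0 < ?x" and y: "0 < ?y" using Fpos Suc.prems by auto
    \<comment> \<open>The ratio that the induction hypothesis bounds by \<open>\<sigma> - k * \<epsilon>\<close>.\<close>
    define s where "s = ?y / ?x"
    have s0: "0 < s" using x y by (simp add: s_def)
    have IH: "s \<le> \<sigma> - real k * \<epsilon>" using Suc x by (simp add: s_def divide_le_eq)
    moreover have "0 \<le> real k * \<epsilon>" using \<epsilon>(1) by simp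
    ultimately have s\<sigma>: "s \<le> \<sigma>" by linarith
    then have s1: "s \<le> 1" using \<open>\<sigma> \<le> 1\<close> by linarith
    \<comment> \<open>The new ray vertex may have further neighbours, which only make the subtracted term larger.\<close>
    have "F (Suc k) - neighbors E (r (Suc k)) \<subseteq> F k"
      using r(3)[of k] Suc.prems by (auto simp: F_def neighbors_def lessThan_Suc)
    then have "?x \<le> ?Z (F (Suc k) - neighbors E (r (Suc k)))"
      using indep_poly_antimono[OF loop _ pos, of "F k"] q F[of k] Suc.prems by auto
    then have "?z \<le> ?y - q * ?x"
      using step[of "Suc k"] Suc.prems q by simp
    also have "\<dots> = (s\<^sup>2 - (s\<^sup>2 - s + q)) * ?x" using x by (simp add: s_def algebra_simps)
    also have "\<dots> \<le> (s\<^sup>2 - \<epsilon>) * ?x"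
      using \<epsilon>(2)[OF s0] s\<sigma> x unfolding \<sigma>_def by (intro mult_right_mono) auto
    also have "\<dots> \<le> (s\<^sup>2 - \<epsilon> * s) * ?x"
      using x s1 \<epsilon>(1) by (intro mult_right_mono) auto
    also have "\<dots> = (s - \<epsilon>) * ?y" using x by (simp add: s_def power2_eq_square algebra_simps)
    also have "\<dots> \<le> (\<sigma> - real (Suc k) * \<epsilon>) * ?y"
      using IH y by (intro mult_right_mono) (auto simp: algebra_simps)
    finally show ?case .
  qed
  from this[of n] Fpos[of n] Fpos[of "Suc n"] have "0 < (\<sigma> - real n * \<epsilon>) * ?Z (F n)" by simp
  then have "0 < \<sigma> - real n * \<epsilon>" using Fpos[of n] by (simp add: zero_less_mult_iff)
  then show ?thesis using \<open>\<sigma> \<le> 1\<close> by linarith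
qed

section \<open>Hard-core processes and inclusion probabilities\<close>

text \<open>The infima in the definition range over walk lengths, so distance at most \<open>1\<close> means a walk of length
  \<open>0\<close> or \<open>1\<close>.\<close>

lemma graph_set_dist_gt_1_iff:
  "graph_set_dist E A B > 1 \<longleftrightarrow> (\<forall>u\<in>A. \<forall>v\<in>B. u \<noteq> v \<and> {u, v} \<notin> E)"
proof
  assume far: "graph_set_dist E A B > 1"
  show "\<forall>u\<in>A. \<forall>v\<in>B. u \<noteq> v \<and> {u, v} \<notin> E"
  proof (intro ballI)
    fix u v assume uv: "u \<in> A" "v \<in> B"
    have "1 < n" if "(u, v) \<in> adj_rel E ^^ n" for n
    proof -
      have "1 < graph_set_dist E A B" by (rule far)
      also have "\<dots> \<le> graph_dist E u v"
        unfolding graph_set_dist_def using uv by (meson INF_lower2 order_refl)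
      also have "\<dots> \<le> enat n"
        unfolding graph_dist_def using that by (intro INF_lower) auto
      finally show ?thesis by (simp add: one_enat_def)
    qed
    from this[of 0] this[of 1] show "u \<noteq> v \<and> {u, v} \<notin> E"
      by (auto simp: adj_rel_def)
  qed
next
  assume sep: "\<forall>u\<in>A. \<forall>v\<in>B. u \<noteq> v \<and> {u, v} \<notin> E"
  have "2 \<le> n" if "u \<in> A" "v \<in> B" "(u, v) \<in> adj_rel E ^^ n" for u v n
  proof (rule ccontr)
    assume "\<not> 2 \<le> n"
    then have "n = 0 \<or> n = 1" by auto
    then show False using that sep by (auto simp: adj_rel_def)
  qed
  then have "2 \<le> graph_set_dist E A B"
    unfolding graph_set_dist_def graph_dist_def
    by (intro INF_greatest) (auto simp: numeral_eq_enat)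
  then show "graph_set_dist E A B > 1"
    by (rule less_le_trans[rotated]) (simp add: numeral_eq_enat one_enat_def)
qed

lemma binary_process_cases:
  assumes "binary_process V M J" "v \<in> V" "\<omega> \<in> space M"
  shows "J v \<omega> = 0 \<or> J v \<omega> = 1"
  using measurable_space[of "J v" M "count_space {0, 1}" \<omega>] assms
  by (auto simp: binary_process_def)

lemma all_one_event:
  assumes "binary_process V M J" "finite T" "T \<subseteq> V"
  shows "{\<omega> \<in> space M. \<forall>v\<in>T. J v \<omega> = 1} \<in> sets M"
proof (rule sets.sets_Collect_finite_All[OF _ assms(2)])
  fix v assume "v \<in> T"
  then have "J v \<in> measurable M (count_space {0, 1})"
    using assms by (auto simp: binary_process_def)
  then have "J v -` {1} \<inter> space M \<in> sets M" by (rule measurable_sets) simp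
  then show "{\<omega> \<in> space M. J v \<omega> = 1} \<in> sets M" by (simp add: vimage_def Int_def conj_commute)
qed

lemma restr_process_measurable:
  assumes "binary_process V M J" "A \<subseteq> V"
  shows "restr_process J A \<in> measurable M (binary_space A)"
  unfolding restr_process_def using assms
  by (intro measurable_restrict) (auto simp: binary_process_def)

text \<open>The events "all of \<open>T\<close> is occupied", for finite \<open>T \<subseteq> A\<close>, form an intersection-stable generator of the
  \<open>\<sigma>\<close>-algebra of the restriction to \<open>A\<close>, because each variable takes only two values. Independence
  on such generators extends to the generated \<open>\<sigma>\<close>-algebras, also for infinite \<open>A\<close> and \<open>B\<close>.\<close>

lemma one_dependent_if_far_independent:
  assumes bin: "binary_process V M J"
    and indep: "\<And>S T. finite S \<Longrightarrow> finite T \<Longrightarrow> S \<subseteq> V \<Longrightarrow> T \<subseteq> V \<Longrightarrow> graph_set_dist E S T > 1 \<Longrightarrow>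
       measure M {\<omega> \<in> space M. \<forall>v\<in>S \<union> T. J v \<omega> = 1} =
       measure M {\<omega> \<in> space M. \<forall>v\<in>S. J v \<omega> = 1} * measure M {\<omega> \<in> space M. \<forall>v\<in>T. J v \<omega> = 1}"
  shows "one_dependent V E M J"
  unfolding one_dependent_def
proof (intro allI impI, elim conjE)
  interpret prob_space M using bin by (simp add: binary_process_def)
  let ?one = "\<lambda>T. {\<omega> \<in> space M. \<forall>v\<in>T. J v \<omega> = 1}"
  define G where "G A = {?one T | T. finite T \<and> T \<subseteq> A}" for A
  have G_sub: "G A \<subseteq> sets M" if "A \<subseteq> V" for A
    using all_one_event[OF bin] that unfolding G_def by auto
  have G_Int: "Int_stable (G A)" for A
  proof (rule Int_stableI)
    fix a b assume "a \<in> G A" "b \<in> G A"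
    then obtain S T where "finite S" "S \<subseteq> A" "a = ?one S" "finite T" "T \<subseteq> A" "b = ?one T"
      unfolding G_def by blast
    then show "a \<inter> b \<in> G A"
      unfolding G_def by (intro CollectI exI[of _ "S \<union> T"]) blast
  qed
  have gen: "sigma_sets (space M) {restr_process J A -` X \<inter> space M | X. X \<in> sets (binary_space A)}
      \<subseteq> sigma_sets (space M) (G A)" if A: "A \<subseteq> V" for A
  proof -
    let ?\<Sigma> = "sigma (space M) (G A)"
    have sp: "G A \<subseteq> Pow (space M)" unfolding G_def by auto
    have "J v \<in> measurable ?\<Sigma> (count_space {0, 1})" if v: "v \<in> A" for v
    proof (subst measurable_count_space_eq2)
      have one: "J v -` {1} \<inter> space M \<in> sigma_sets (space M) (G A)"
        using v by (intro sigma_sets.Basic) (auto simp: G_def intro!: exI[of _ "{v}"])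
      have zero: "J v -` {0} \<inter> space M = space M - (J v -` {1} \<inter> space M)"
        using binary_process_cases[OF bin, of v] A v by force
      have bits: "J v \<omega> \<in> {0, 1}" if "\<omega> \<in> space M" for \<omega>
        using binary_process_cases[OF bin _ that] A v by blast
      have "J v -` {0} \<inter> space M \<in> sigma_sets (space M) (G A)"
        unfolding zero by (rule sigma_sets.Compl[OF one])
      with one bits show "J v \<in> space ?\<Sigma> \<rightarrow> {0, 1} \<and> (\<forall>a\<in>{0, 1}. J v -` {a} \<inter> space ?\<Sigma> \<in> sets ?\<Sigma>)"
        unfolding space_measure_of[OF sp] sets_measure_of[OF sp] by blast
    qed simp
    then have "restr_process J A \<in> measurable ?\<Sigma> (binary_space A)"
      unfolding restr_process_def by (intro measurable_restrict)
    then have "restr_process J A -` X \<inter> space M \<in> sigma_sets (space M) (G A)"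
      if "X \<in> sets (binary_space A)" for X
      using measurable_sets[OF _ that, of "restr_process J A" ?\<Sigma>]
      unfolding space_measure_of[OF sp] sets_measure_of[OF sp] by simp
    then show ?thesis by (intro sigma_sets_mono) auto
  qed
  fix A B assume AB: "A \<subseteq> V" "B \<subseteq> V" "graph_set_dist E A B > 1"
  have "indep_set (G A) (G B)"
  proof (rule indep_setI[OF G_sub G_sub])
    fix a b assume "a \<in> G A" "b \<in> G B"
    then obtain S T where ST: "finite S" "S \<subseteq> A" "a = ?one S" "finite T" "T \<subseteq> B" "b = ?one T"
      unfolding G_def by auto
    have "graph_set_dist E S T > 1"
      using AB ST unfolding graph_set_dist_gt_1_iff by blast
    from indep[OF ST(1,4) _ _ this] ST AB
    have "prob (?one (S \<union> T)) = prob (?one S) * prob (?one T)" by auto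
    moreover have "?one (S \<union> T) = ?one S \<inter> ?one T" by auto
    ultimately show "prob (a \<inter> b) = prob a * prob b" using ST by simp
  qed (use AB in auto)
  then have indep_G: "indep_set (sigma_sets (space M) (G A)) (sigma_sets (space M) (G B))"
    by (rule indep_set_sigma_sets[OF _ G_Int G_Int])
  have events: "sigma_sets (space M) (G C) \<subseteq> sets M" if "C \<subseteq> V" for C
    using G_sub[OF that] by (rule sets.sigma_sets_subset)
  let ?P = "\<lambda>A. sigma_sets (space M) {restr_process J A -` X \<inter> space M | X. X \<in> sets (binary_space A)}"
  have "indep_set (?P A) (?P B)"
  proof (rule indep_setI)
    show "?P A \<subseteq> events" "?P B \<subseteq> events"
      using gen[OF AB(1)] events[OF AB(1)] gen[OF AB(2)] events[OF AB(2)] by (blast dest: subset_trans)+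
    fix a b assume "a \<in> ?P A" "b \<in> ?P B"
    then show "prob (a \<inter> b) = prob a * prob b"
      by (intro indep_setD[OF indep_G] subsetD[OF gen[OF AB(1)]] subsetD[OF gen[OF AB(2)]])
  qed
  then show "indep_var (binary_space A) (restr_process J A) (binary_space B) (restr_process J B)"
    unfolding indep_var_eq using restr_process_measurable[OF bin] AB by blast
qed

text \<open>The given probabilities factorise over sets at distance greater than \<open>1\<close>, since an independent set
  in the union is a union of two independent sets. Countability of \<open>V\<close> lets the almost sure
  exclusion along single edges hold along all edges at once.\<close>

lemma one_dep_hard_core_if_inclusion_probs:
  assumes V: "countable V" and loop: "\<And>v. {v} \<notin> E"
    and bin: "binary_process V M J"
    and incl: "\<And>T. finite T \<Longrightarrow> T \<subseteq> V \<Longrightarrow> measure M {\<omega> \<in> space M. \<forall>v\<in>T. J v \<omega> = 1} =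
       (if independent_set E T then p ^ card T else 0)"
  shows "one_dep_hard_core_process V E M J p"
proof -
  interpret prob_space M using bin by (simp add: binary_process_def)
  have "one_dependent V E M J"
  proof (rule one_dependent_if_far_independent[OF bin])
    fix S T assume ST: "finite S" "finite T" "S \<subseteq> V" "T \<subseteq> V" "graph_set_dist E S T > 1"
    then have sep: "\<forall>u\<in>S. \<forall>v\<in>T. u \<noteq> v \<and> {u, v} \<notin> E" unfolding graph_set_dist_gt_1_iff by simp
    moreover have "\<forall>u\<in>T. \<forall>v\<in>S. {u, v} \<notin> E" using sep by (metis insert_commute)
    ultimately have "independent_set E (S \<union> T) \<longleftrightarrow> independent_set E S \<and> independent_set E T"
      unfolding independent_set_def by blast
    moreover have "S \<inter> T = {}" using sep by auto
    ultimately show "prob {\<omega> \<in> space M. \<forall>v\<in>S \<union> T. J v \<omega> = 1} =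
       prob {\<omega> \<in> space M. \<forall>v\<in>S. J v \<omega> = 1} * prob {\<omega> \<in> space M. \<forall>v\<in>T. J v \<omega> = 1}"
      using ST incl[of S] incl[of T] incl[of "S \<union> T"]
      by (simp add: card_Un_disjoint power_add)
  qed
  moreover have "hard_core V E M J"
  proof -
    have "AE \<omega> in M. {u, v} \<in> E \<longrightarrow> \<not> (J u \<omega> = 1 \<and> J v \<omega> = 1)" if uv: "u \<in> V" "v \<in> V" for u v
    proof (cases "{u, v} \<in> E")
      case True
      then have "\<not> independent_set E {u, v}" by (auto simp: independent_set_def)
      then have "prob {\<omega> \<in> space M. \<forall>v\<in>{u, v}. J v \<omega> = 1} = 0"
        using incl[of "{u, v}"] uv by simp
      then have "AE \<omega> in M. \<omega> \<notin> {\<omega> \<in> space M. \<forall>v\<in>{u, v}. J v \<omega> = 1}"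
        using prob_eq_0[OF all_one_event[OF bin, of "{u, v}"]] uv by simp
      then show ?thesis by (rule AE_mp) auto
    qed simp
    then show ?thesis unfolding hard_core_def using V by (simp add: AE_ball_countable)
  qed
  moreover have "measure M {\<omega> \<in> space M. J v \<omega> = 1} = p" if "v \<in> V" for v
    using incl[of "{v}"] that loop by (simp add: independent_set_def)
  ultimately show ?thesis using bin by (simp add: one_dep_hard_core_process_def)
qed

text \<open>A vertex of an independent set is at distance greater than \<open>1\<close> from the rest of the set, so
  1-dependence splits off one factor \<open>p\<close> at a time.\<close>

lemma inclusion_probs:
  assumes J: "one_dep_hard_core_process V E M J p" and T: "finite T" "T \<subseteq> V"
  shows "measure M {\<omega> \<in> space M. \<forall>v\<in>T. J v \<omega> = 1} =
     (if independent_set E T then p ^ card T else 0)"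
proof -
  have bin: "binary_process V M J" and dep: "one_dependent V E M J" and hc: "hard_core V E M J"
    and p: "\<And>v. v \<in> V \<Longrightarrow> measure M {\<omega> \<in> space M. J v \<omega> = 1} = p"
    using J by (auto simp: one_dep_hard_core_process_def)
  interpret prob_space M using bin by (simp add: binary_process_def)
  let ?one = "\<lambda>T. {\<omega> \<in> space M. \<forall>v\<in>T. J v \<omega> = 1}"
  show ?thesis
  proof (cases "independent_set E T")
    case False
    then obtain u v where uv: "u \<in> T" "v \<in> T" "{u, v} \<in> E" by (auto simp: independent_set_def)
    then have "AE \<omega> in M. \<omega> \<notin> ?one T"
      using hc[unfolded hard_core_def] T(2) by (elim eventually_mono) blast
    then show ?thesis
      using False prob_eq_0[OF all_one_event[OF bin T]] by simp
  next
    case True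
    have "prob (?one T) = p ^ card T" using T True
    proof (induction T rule: finite_induct)
      case (insert v T)
      have T: "finite T" "T \<subseteq> V" "{v} \<subseteq> V" using insert by auto
      have "graph_set_dist E {v} T > 1"
        using insert unfolding graph_set_dist_gt_1_iff independent_set_def by auto
      then have iv: "indep_var (binary_space {v}) (restr_process J {v}) (binary_space T) (restr_process J T)"
        using dep T by (simp add: one_dependent_def)
      have ev: "{x \<in> space (binary_space A). \<forall>v\<in>A. x v = 1} \<in> sets (binary_space A)"
        if "finite A" for A :: "'a set"
        using that by measurable
      have pre: "restr_process J A -` {x \<in> space (binary_space A). \<forall>v\<in>A. x v = 1} \<inter> space M = ?one A"
        if "A \<subseteq> V" for A
        using measurable_space[OF restr_process_measurable[OF bin that]]
        by (auto simp: restr_process_def)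
      define ones :: "'a set \<Rightarrow> ('a \<Rightarrow> nat) set" where
        "ones A = {x \<in> space (binary_space A). \<forall>v\<in>A. x v = 1}" for A
      have "?one (insert v T) = ?one {v} \<inter> ?one T" by auto
      also have "\<dots> = (\<lambda>\<omega>. (restr_process J {v} \<omega>, restr_process J T \<omega>)) -` (ones {v} \<times> ones T) \<inter> space M"
        unfolding pre[OF T(2), symmetric] pre[OF T(3), symmetric] ones_def[symmetric] by blast
      also have "prob \<dots> = prob (?one {v}) * prob (?one T)"
        unfolding pre[OF T(2), symmetric] pre[OF T(3), symmetric] ones_def
        using indep_varD[OF iv ev ev] T by simp
      also have "prob (?one T) = p ^ card T"
        using insert by (auto simp: independent_set_def)
      finally show ?case using insert p[of v] by simp
    qed (simp add: prob_space)
    then show ?thesis using True by simp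
  qed
qed

text \<open>Retain each occupied vertex independently with probability \<open>c = q / p\<close>, so that the marginal becomes
  \<open>q\<close>. The polynomial is the probability that no retained vertex lies in \<open>H\<close>, which given the process
  is a product of factors \<open>1\<close> and \<open>1 - c\<close>, and hence at least \<open>(1 - c) ^ card H\<close>. Rather than
  constructing the thinned process, the proof takes the expectation of that product.\<close>

lemma indep_poly_pos_if_process:
  assumes J: "one_dep_hard_core_process V E M J p" and q: "0 \<le> q" "q < p" and H: "finite H" "H \<subseteq> V"
  shows "0 < indep_poly E q H"
proof -
  have bin: "binary_process V M J" using J by (simp add: one_dep_hard_core_process_def)
  interpret prob_space M using bin by (simp add: binary_process_def)
  let ?one = "\<lambda>T. {\<omega> \<in> space M. \<forall>v\<in>T. J v \<omega> = 1}"
  define c where "c = q / p"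
  have c: "0 \<le> c" "c < 1" "c * p = q" using q by (auto simp: c_def)
  have "(\<Prod>v\<in>H. 1 - c * real (J v \<omega>)) = (\<Sum>S\<in>Pow H. (- c) ^ card S * indicator (?one S) \<omega>)"
    if \<omega>: "\<omega> \<in> space M" for \<omega>
  proof -
    have "(\<Prod>v\<in>H. - c * real (J v \<omega>) + 1) =
        (\<Sum>S\<in>Pow H. (\<Prod>v\<in>S. - c * real (J v \<omega>)) * (\<Prod>v\<in>H - S. 1))"
      by (rule prod_add[OF H(1)])
    also have "\<dots> = (\<Sum>S\<in>Pow H. (- c) ^ card S * indicator (?one S) \<omega>)"
    proof (rule sum.cong[OF refl])
      fix S assume S: "S \<in> Pow H"
      then have "finite S" using H(1) finite_subset by auto
      have bit: "J v \<omega> = 0 \<or> J v \<omega> = 1" if "v \<in> S" for v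
        using binary_process_cases[OF bin _ \<omega>, of v] S H(2) that by blast
      have "(\<Prod>v\<in>S. real (J v \<omega>)) = indicator (?one S) \<omega>"
      proof (cases "\<omega> \<in> ?one S")
        case False
        then obtain v where "v \<in> S" "J v \<omega> = 0" using \<omega> bit by blast
        then have "(\<Prod>v\<in>S. real (J v \<omega>)) = 0" using \<open>finite S\<close> by (auto intro: prod_zero)
        with False show ?thesis by simp
      qed simp
      then show "(\<Prod>v\<in>S. - c * real (J v \<omega>)) * (\<Prod>v\<in>H - S. 1) = (- c) ^ card S * indicator (?one S) \<omega>"
        unfolding prod.distrib by simp
    qed
    finally show ?thesis by (simp add: algebra_simps)
  qed
  then have "(1 - c) ^ card H \<le> (\<Sum>S\<in>Pow H. (- c) ^ card S * indicator (?one S) \<omega>)" if \<omega>: "\<omega> \<in> space M" for \<omega>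
  proof -
    have "(1 - c) ^ card H = (\<Prod>v\<in>H. 1 - c)" by simp
    also have "\<dots> \<le> (\<Prod>v\<in>H. 1 - c * real (J v \<omega>))"
    proof (rule prod_mono)
      fix v assume "v \<in> H"
      then have "J v \<omega> = 0 \<or> J v \<omega> = 1" using binary_process_cases[OF bin _ \<omega>, of v] H(2) by blast
      then show "0 \<le> 1 - c \<and> 1 - c \<le> 1 - c * real (J v \<omega>)" using c by auto
    qed
    finally show ?thesis using \<open>\<And>\<omega>. \<omega> \<in> space M \<Longrightarrow> _ = _\<close>[OF \<omega>] by simp
  qed
  moreover have meas: "?one S \<in> sets M" if "S \<subseteq> H" for S
    using that H all_one_event[OF bin] by (meson finite_subset subset_trans)
  ultimately have "(1 - c) ^ card H \<le> expectation (\<lambda>\<omega>. \<Sum>S\<in>Pow H. (- c) ^ card S * indicator (?one S) \<omega>)"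
    by (intro integral_ge_const AE_I2) (auto simp: less_top[symmetric])
  also have "\<dots> = (\<Sum>S\<in>Pow H. (- c) ^ card S * prob (?one S))"
    using meas by (subst Bochner_Integration.integral_sum) (auto simp: less_top[symmetric])
  also have "\<dots> = (\<Sum>S\<in>Pow H. if independent_set E S then (- q) ^ card S else 0)"
  proof (rule sum.cong[OF refl])
    fix S assume "S \<in> Pow H"
    then have "finite S" "S \<subseteq> V" using H by (auto intro: finite_subset)
    from inclusion_probs[OF J this] c(3)
    show "(- c) ^ card S * prob (?one S) = (if independent_set E S then (- q) ^ card S else 0)"
      by (simp add: power_mult_distrib[symmetric])
  qed
  also have "\<dots> = indep_poly E q H"
    using H(1) by (simp add: indep_poly_def sum.If_cases Pow_def Collect_conj_eq)
  finally show ?thesis using c(2) by (meson less_le_trans zero_less_power diff_gt_0_iff_gt)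
qed

section \<open>Processes with prescribed inclusion probabilities\<close>

text \<open>If \<open>w T\<close> is the probability that all of \<open>T\<close> is occupied, then by inclusion-exclusion this is the
  probability that \<open>S\<close> is exactly the set of occupied vertices in \<open>H\<close>.\<close>

definition exact_prob :: "('a set \<Rightarrow> real) \<Rightarrow> 'a set \<Rightarrow> 'a set \<Rightarrow> real" where
  "exact_prob w H S = (\<Sum>U\<in>Pow (H - S). (- 1) ^ card U * w (S \<union> U))"

text \<open>In the sum for \<open>S\<close> over \<open>insert v H\<close>, the terms with \<open>v \<in> U\<close> are those for \<open>insert v S\<close> with the opposite
  sign.\<close>

lemma exact_prob_insert:
  assumes "finite H" "v \<notin> H" "S \<subseteq> H"
  shows "exact_prob w (insert v H) S + exact_prob w (insert v H) (insert v S) = exact_prob w H S"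
proof -
  let ?D = "H - S"
  have D: "insert v H - S = insert v ?D" "insert v H - insert v S = ?D" and v: "v \<notin> ?D"
    using assms by auto
  have inj: "inj_on (insert v) (Pow ?D)" using v by (auto intro!: inj_onI)
  have "(\<Sum>U\<in>insert v ` Pow ?D. (- 1) ^ card U * w (S \<union> U)) =
      (\<Sum>U\<in>Pow ?D. (- 1) ^ card (insert v U) * w (S \<union> insert v U))"
    using inj by (simp add: sum.reindex)
  also have "\<dots> = (\<Sum>U\<in>Pow ?D. - ((- 1) ^ card U * w (insert v S \<union> U)))"
  proof (rule sum.cong[OF refl])
    fix U assume "U \<in> Pow ?D"
    then have "finite U" "v \<notin> U" using assms by (auto intro: finite_subset)
    then show "(- 1) ^ card (insert v U) * w (S \<union> insert v U) = - ((- 1) ^ card U * w (insert v S \<union> U))"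
      by simp
  qed
  also have "\<dots> = - exact_prob w (insert v H) (insert v S)"
    by (simp add: exact_prob_def D sum_negf)
  finally show ?thesis
    unfolding exact_prob_def[of w "insert v H" S] exact_prob_def[of w H] D Pow_insert
    using v assms(1) by (subst sum.union_disjoint) auto
qed

text \<open>The candidate laws on \<open>J\<close> and on \<open>J \<union> K\<close> are consistent: summing over the configurations outside \<open>J\<close>
  gives the law on \<open>J\<close>.\<close>

lemma sum_exact_prob:
  assumes "finite J" "finite K" "J \<inter> K = {}" "S \<subseteq> J"
  shows "(\<Sum>U\<in>Pow K. exact_prob w (J \<union> K) (S \<union> U)) = exact_prob w J S"
  using assms(2,3)
proof (induction K rule: finite_induct)
  case (insert v K)
  have inj: "inj_on (insert v) (Pow K)" using insert.hyps by (auto intro!: inj_onI)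
  have eq: "exact_prob w (insert v (J \<union> K)) (S \<union> U) + exact_prob w (insert v (J \<union> K)) (insert v (S \<union> U)) =
      exact_prob w (J \<union> K) (S \<union> U)" if "U \<in> Pow K" for U
    using insert assms that by (intro exact_prob_insert) auto
  have "(\<Sum>U\<in>Pow (insert v K). exact_prob w (J \<union> insert v K) (S \<union> U)) =
      (\<Sum>U\<in>Pow K. exact_prob w (insert v (J \<union> K)) (S \<union> U)) +
      (\<Sum>U\<in>Pow K. exact_prob w (insert v (J \<union> K)) (insert v (S \<union> U)))"
    unfolding Pow_insert using insert.hyps inj
    by (subst sum.union_disjoint) (auto simp: sum.reindex)
  also have "\<dots> = (\<Sum>U\<in>Pow K. exact_prob w (J \<union> K) (S \<union> U))"
    unfolding sum.distrib[symmetric] by (rule sum.cong[OF refl eq])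
  finally show ?case using insert by auto
qed simp

text \<open>The numbers \<open>exact_prob w H\<close> are the weights of a probability distribution on the subsets of \<open>H\<close>, and
  by \<open>sum_exact_prob\<close> these distributions form a projective family. Kolmogorov's extension theorem
  requires a Polish state space; the states \<open>0\<close> and \<open>1\<close> are placed in the reals, and the process is read
  off the coordinates afterwards.\<close>

lemma process_with_inclusion_probs:
  fixes V :: "'a set"
  assumes w0: "w {} = 1"
    and nonneg: "\<And>H S. finite H \<Longrightarrow> H \<subseteq> V \<Longrightarrow> S \<subseteq> H \<Longrightarrow> 0 \<le> exact_prob w H S"
  shows "\<exists>(M :: ('a \<Rightarrow> real) measure) J. binary_process V M J \<and>
    (\<forall>T. finite T \<longrightarrow> T \<subseteq> V \<longrightarrow> measure M {\<omega> \<in> space M. \<forall>v\<in>T. J v \<omega> = 1} = w T)"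
proof -
  define q where "q H = embed_pmf (\<lambda>S. if S \<subseteq> H then exact_prob w H S else 0)" for H
  have pmf_q: "pmf (q H) S = (if S \<subseteq> H then exact_prob w H S else 0)" if H: "finite H" "H \<subseteq> V" for H S
    unfolding q_def
  proof (rule pmf_embed_pmf)
    have "(\<Sum>S\<in>Pow H. exact_prob w H S) = 1"
      using sum_exact_prob[of "{}" H "{}" w] H w0 by (simp add: exact_prob_def[of _ "{}"])
    moreover have "(\<integral>\<^sup>+ S. ennreal (if S \<subseteq> H then exact_prob w H S else 0) \<partial>count_space UNIV) =
        (\<Sum>S\<in>Pow H. ennreal (exact_prob w H S))"
      using H by (subst nn_integral_count_space'[of "Pow H"]) (auto intro!: sum.cong)
    ultimately show "(\<integral>\<^sup>+ S. ennreal (if S \<subseteq> H then exact_prob w H S else 0) \<partial>count_space UNIV) = 1"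
      using nonneg H by (subst (asm) sum_ennreal) auto
  qed (use nonneg H in auto)
  have marginal: "map_pmf (\<lambda>S. S \<inter> J) (q H) = q J" if J: "J \<subseteq> H" "finite H" "H \<subseteq> V" for J H
  proof (rule pmf_eqI)
    fix S
    have JV: "finite J" "J \<subseteq> V" using J by (auto intro: finite_subset)
    have "pmf (map_pmf (\<lambda>S. S \<inter> J) (q H)) S = measure (q H) {S'. S' \<inter> J = S}"
      by (simp add: pmf_map vimage_def)
    also have "\<dots> = measure (q H) ({S'. S' \<inter> J = S} \<inter> set_pmf (q H))"
      by (simp add: measure_Int_set_pmf)
    also have "\<dots> = measure (q H) ({S' \<in> Pow H. S' \<inter> J = S} \<inter> set_pmf (q H))"
      using J by (intro arg_cong2[where f = measure]) (auto simp: set_pmf_eq pmf_q split: if_splits)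
    also have "\<dots> = measure (q H) {S' \<in> Pow H. S' \<inter> J = S}"
      by (simp add: measure_Int_set_pmf)
    also have "\<dots> = (\<Sum>S' | S' \<in> Pow H \<and> S' \<inter> J = S. exact_prob w H S')"
      using J by (subst measure_measure_pmf_finite) (auto simp: pmf_q)
    also have "\<dots> = pmf (q J) S"
    proof (cases "S \<subseteq> J")
      case True
      have "{S'. S' \<in> Pow H \<and> S' \<inter> J = S} = (\<union>) S ` Pow (H - J)"
      proof (intro equalityI subsetI)
        fix S' assume "S' \<in> {S'. S' \<in> Pow H \<and> S' \<inter> J = S}"
        then have "S' = S \<union> (S' - J)" "S' - J \<in> Pow (H - J)" by auto
        then show "S' \<in> (\<union>) S ` Pow (H - J)" by blast
      qed (use True J in auto)
      moreover have "inj_on ((\<union>) S) (Pow (H - J))" using True by (auto intro!: inj_onI)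
      ultimately have "(\<Sum>S' | S' \<in> Pow H \<and> S' \<inter> J = S. exact_prob w H S') =
          (\<Sum>U\<in>Pow (H - J). exact_prob w H (S \<union> U))"
        by (simp add: sum.reindex)
      also have "\<dots> = exact_prob w J S"
        using sum_exact_prob[of J "H - J" S w] True J JV by (simp add: Un_absorb1)
      finally show ?thesis using True JV by (simp add: pmf_q)
    next
      case False
      then have "{S'. S' \<in> Pow H \<and> S' \<inter> J = S} = {}" by auto
      then have "(\<Sum>S' | S' \<in> Pow H \<and> S' \<inter> J = S. exact_prob w H S') = 0" by (simp only: sum.empty)
      then show ?thesis using False JV by (simp add: pmf_q)
    qed
    finally show "pmf (map_pmf (\<lambda>S. S \<inter> J) (q H)) S = pmf (q J) S" .
  qed
  define P :: "'a set \<Rightarrow> ('a \<Rightarrow> real) measure"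
    where "P J = distr (measure_pmf (q J)) (PiM J (\<lambda>_. borel)) (\<lambda>S. restrict (indicator S) J)" for J
  have meas: "(\<lambda>S. restrict (indicator S) J) \<in> measurable (measure_pmf (q H)) (PiM J (\<lambda>_. borel :: real measure))"
    for J H by (simp add: space_PiM)
  have "projective_family V P (\<lambda>_. borel)"
  proof (rule projective_family.intro)
    fix J H assume J: "J \<subseteq> H" "finite H" "H \<subseteq> V"
    have "P J = distr (distr (q H) (count_space UNIV) (\<lambda>S. S \<inter> J)) (PiM J (\<lambda>_. borel)) (\<lambda>S. restrict (indicator S) J)"
      unfolding P_def marginal[OF J, symmetric] by (simp add: map_pmf_rep_eq)
    also have "\<dots> = distr (q H) (PiM J (\<lambda>_. borel)) (\<lambda>S. restrict (indicator S) J)"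
      by (subst distr_distr) (auto simp: space_PiM o_def indicator_def intro!: distr_cong)
    also have "\<dots> = distr (P H) (PiM J (\<lambda>_. borel)) (\<lambda>f. restrict f J)"
      unfolding P_def using J
      by (subst distr_distr[OF measurable_restrict_subset meas]) (auto simp: o_def Int_absorb1 intro!: distr_cong)
    finally show "P J = distr (P H) (PiM J (\<lambda>_. borel)) (\<lambda>f. restrict f J)" .
  next
    fix J :: "'a set" assume "finite J" "J \<subseteq> V"
    show "prob_space (P J)" unfolding P_def by (rule measure_pmf.prob_space_distr[OF meas])
  qed
  then interpret polish_projective V P by (rule polish_projective.intro)
  define J :: "'a \<Rightarrow> ('a \<Rightarrow> real) \<Rightarrow> nat" where "J v \<omega> = (if \<omega> v = 1 then 1 else 0)" for v \<omega>
  have "binary_process V lim J"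
    unfolding binary_process_def
  proof (intro conjI ballI)
    show "prob_space lim" by (rule P.prob_space_axioms)
    fix v assume "v \<in> V"
    then have [measurable]: "(\<lambda>\<omega>. \<omega> v) \<in> borel_measurable lim"
      by (simp add: measurable_component_singleton cong: measurable_cong_sets)
    show "J v \<in> measurable lim (count_space {0, 1})"
      unfolding J_def by measurable
  qed
  moreover have "measure lim {\<omega> \<in> space lim. \<forall>v\<in>T. J v \<omega> = 1} = w T" if T: "finite T" "T \<subseteq> V" for T
  proof -
    let ?X = "{x \<in> space (PiM T (\<lambda>_. borel :: real measure)). \<forall>v\<in>T. x v = 1}"
    have X: "?X \<in> sets (PiM T (\<lambda>_. borel))" using T by measurable
    have "{\<omega> \<in> space lim. \<forall>v\<in>T. J v \<omega> = 1} = emb V T ?X"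
      using T by (auto simp: prod_emb_def space_PiM J_def PiE_def split: if_splits)
    then have "measure lim {\<omega> \<in> space lim. \<forall>v\<in>T. J v \<omega> = 1} = measure (P T) ?X"
      using measure_lim_emb[OF T(2,1) X] by simp
    also have "\<dots> = measure (q T) {S. T \<subseteq> S}"
      unfolding P_def by (subst measure_distr[OF meas X])
        (auto simp: space_PiM indicator_def intro!: arg_cong2[where f = measure] split: if_splits)
    also have "\<dots> = measure (q T) ({S. T \<subseteq> S} \<inter> set_pmf (q T))"
      by (simp add: measure_Int_set_pmf)
    also have "\<dots> = measure (q T) ({T} \<inter> set_pmf (q T))"
      using T by (intro arg_cong2[where f = measure]) (auto simp: set_pmf_eq pmf_q split: if_splits)
    also have "\<dots> = pmf (q T) T" by (simp add: measure_Int_set_pmf measure_pmf_single)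
    also have "\<dots> = w T" using T by (simp add: pmf_q exact_prob_def)
    finally show ?thesis .
  qed
  ultimately show ?thesis by blast
qed

section \<open>The critical point and the independence polynomial\<close>

text \<open>For an independent \<open>S\<close> only those sets \<open>U\<close> contribute that are independent and have no neighbour in
  \<open>S\<close>. Factoring out \<open>p ^ card S\<close> leaves the independence polynomial of the vertices of \<open>H\<close> that are
  neither in \<open>S\<close> nor adjacent to it. For other \<open>S\<close> all terms vanish.\<close>

lemma exact_prob_hard_core_nonneg:
  assumes p: "0 \<le> p" and nonneg: "\<forall>K. finite K \<and> K \<subseteq> V \<longrightarrow> 0 \<le> indep_poly E p K"
    and H: "finite H" "H \<subseteq> V" and S: "S \<subseteq> H"
  shows "0 \<le> exact_prob (\<lambda>T. if independent_set E T then p ^ card T else 0) H S"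
proof (cases "independent_set E S")
  case True
  define K where "K = H - S - (\<Union>v\<in>S. neighbors E v)"
  have finS: "finite S" using H S finite_subset by auto
  have ind: "independent_set E (S \<union> U) \<longleftrightarrow> U \<subseteq> K \<and> independent_set E U" if "U \<subseteq> H - S" for U
    using True that unfolding independent_set_def K_def neighbors_def
    by (auto simp: insert_commute; blast)
  have "exact_prob (\<lambda>T. if independent_set E T then p ^ card T else 0) H S =
      (\<Sum>U\<in>Pow (H - S). if U \<subseteq> K \<and> independent_set E U then p ^ card S * (- p) ^ card U else 0)"
    unfolding exact_prob_def
  proof (rule sum.cong[OF refl])
    fix U assume U: "U \<in> Pow (H - S)"
    then have "finite U" "S \<inter> U = {}" using H by (auto intro: finite_subset)
    then have "card (S \<union> U) = card S + card U" using finS by (simp add: card_Un_disjoint)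
    moreover have "(- p) ^ card U = (- 1) ^ card U * p ^ card U" by (rule power_minus)
    ultimately show "(- 1) ^ card U * (if independent_set E (S \<union> U) then p ^ card (S \<union> U) else 0) =
        (if U \<subseteq> K \<and> independent_set E U then p ^ card S * (- p) ^ card U else 0)"
      using ind[of U] U by (simp add: power_add)
  qed
  also have "\<dots> = (\<Sum>U | U \<subseteq> K \<and> independent_set E U. p ^ card S * (- p) ^ card U)"
    using H by (intro sum.mono_neutral_cong_right) (auto simp: K_def)
  also have "\<dots> = p ^ card S * indep_poly E p K"
    by (simp add: indep_poly_def sum_distrib_left)
  finally have eq: "exact_prob (\<lambda>T. if independent_set E T then p ^ card T else 0) H S =
      p ^ card S * indep_poly E p K" .
  have "finite K" "K \<subseteq> V" using H unfolding K_def by auto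
  then have "0 \<le> indep_poly E p K" using nonneg by blast
  then show ?thesis using p by (simp add: eq)
next
  case False
  then have "\<not> independent_set E (S \<union> U)" for U by (auto simp: independent_set_def)
  then show ?thesis by (simp add: exact_prob_def)
qed

text \<open>The extension theorem produces a process on real-valued functions; its law under the canonical
  coordinate map has the sample space that \<open>p_h\<close> demands.\<close>

lemma process_if_indep_poly_nonneg:
  fixes V :: "'a set"
  assumes V: "countable V" and loop: "\<And>v. {v} \<notin> E" and p: "0 \<le> p"
    and nonneg: "\<forall>H. finite H \<and> H \<subseteq> V \<longrightarrow> 0 \<le> indep_poly E p H"
  shows "\<exists>(M :: ('a \<Rightarrow> nat) measure) J. one_dep_hard_core_process V E M J p"
proof -
  define w where "w T = (if independent_set E T then p ^ card T else 0)" for T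
  have "w {} = 1" by (simp add: w_def independent_set_def)
  moreover have "0 \<le> exact_prob w H S" if "finite H" "H \<subseteq> V" "S \<subseteq> H" for H S
    unfolding w_def by (rule exact_prob_hard_core_nonneg[OF p nonneg that])
  ultimately obtain M :: "('a \<Rightarrow> real) measure" and J where bin: "binary_process V M J"
    and incl: "\<forall>T. finite T \<longrightarrow> T \<subseteq> V \<longrightarrow> measure M {\<omega> \<in> space M. \<forall>v\<in>T. J v \<omega> = 1} = w T"
    using process_with_inclusion_probs[of w V] by blast
  have "one_dep_hard_core_process V E M J p"
    by (rule one_dep_hard_core_if_inclusion_probs[OF V loop bin])
       (use incl in \<open>simp add: w_def\<close>)
  from one_dep_hard_core_process_canonical[OF this V] show ?thesis by blast
qed

lemma p_h_ge:
  assumes V: "countable V" "V \<noteq> {}" and loop: "\<And>v. {v} \<notin> E" and p: "0 \<le> p"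
    and nonneg: "\<forall>H. finite H \<and> H \<subseteq> V \<longrightarrow> 0 \<le> indep_poly E p H"
  shows "p \<le> p_h V E"
  unfolding p_h_def
proof (rule cSup_upper)
  show "p \<in> {p. \<exists>(M :: ('a \<Rightarrow> nat) measure) J. one_dep_hard_core_process V E M J p}"
    using process_if_indep_poly_nonneg[OF V(1) loop p nonneg] by simp
  obtain v where "v \<in> V" using V by auto
  then show "bdd_above {p. \<exists>(M :: ('a \<Rightarrow> nat) measure) J. one_dep_hard_core_process V E M J p}"
    unfolding one_dep_hard_core_process_def binary_process_def
    by (intro bdd_aboveI[of _ 1]) (auto dest!: bspec intro: prob_space.prob_le_1)
qed

text \<open>At \<open>q = 0\<close> the polynomial is nonnegative, so the set of marginals is nonempty; without this the
  supremum would be unspecified.\<close>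

lemma p_h_le:
  assumes V: "countable V" and loop: "\<And>v. {v} \<notin> E" and q: "0 \<le> q"
    and not_pos: "\<not> (\<forall>H. finite H \<and> H \<subseteq> V \<longrightarrow> 0 < indep_poly E q H)"
  shows "p_h V E \<le> q"
  unfolding p_h_def
proof (rule cSup_least)
  have "0 \<le> indep_poly E 0 H" for H by (auto simp: indep_poly_def intro!: sum_nonneg)
  then show "{p. \<exists>(M :: ('a \<Rightarrow> nat) measure) J. one_dep_hard_core_process V E M J p} \<noteq> {}"
    using process_if_indep_poly_nonneg[OF V loop order_refl] by blast
next
  fix p assume "p \<in> {p. \<exists>(M :: ('a \<Rightarrow> nat) measure) J. one_dep_hard_core_process V E M J p}"
  then obtain M :: "('a \<Rightarrow> nat) measure" and J where J: "one_dep_hard_core_process V E M J p" by auto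
  show "p \<le> q"
  proof (rule ccontr)
    assume "\<not> p \<le> q"
    then show False using indep_poly_pos_if_process[OF J q] not_pos by auto
  qed
qed

section \<open>Bounded-degree graphs\<close>

lemma simple_graph_no_loop: "simple_graph V E \<Longrightarrow> {v} \<notin> E"
  unfolding simple_graph_def by (metis doubleton_eq_iff insert_absorb2)

lemma simple_graph_edge_verts: "simple_graph V E \<Longrightarrow> {u, v} \<in> E \<Longrightarrow> u \<in> V \<and> v \<in> V"
  unfolding simple_graph_def by (metis doubleton_eq_iff)

lemma finite_walk_ends:
  assumes G: "simple_graph V E" and deg: "\<And>v. v \<in> V \<Longrightarrow> finite (neighbors E v)" and v: "v \<in> V"
  shows "finite {u. (v, u) \<in> adj_rel E ^^ n}"
proof -
  have "finite {u. (v, u) \<in> adj_rel E ^^ n} \<and> {u. (v, u) \<in> adj_rel E ^^ n} \<subseteq> V"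
  proof (induction n)
    case (Suc n)
    have "{u. (v, u) \<in> adj_rel E ^^ Suc n} = (\<Union>y\<in>{u. (v, u) \<in> adj_rel E ^^ n}. neighbors E y)"
      by (auto simp: adj_rel_def neighbors_def insert_commute)
    moreover have "neighbors E y \<subseteq> V" for y
      using simple_graph_edge_verts[OF G] by (auto simp: neighbors_def)
    ultimately show ?case using Suc deg by auto
  qed (use v in auto)
  then show ?thesis by blast
qed

text \<open>Walks of a given length from a fixed vertex have only finitely many end points, and every vertex is
  such an end point.\<close>

lemma countable_verts:
  assumes G: "simple_graph V E" "connected_graph V E" and deg: "\<And>v. v \<in> V \<Longrightarrow> finite (neighbors E v)"
  shows "countable V"
proof -
  obtain v where v: "v \<in> V" using G by (auto simp: connected_graph_def)
  have "V \<subseteq> (\<Union>n. {u. (v, u) \<in> adj_rel E ^^ n})"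
    using G v by (auto simp: connected_graph_def rtrancl_power)
  moreover have "countable (\<Union>n. {u. (v, u) \<in> adj_rel E ^^ n})"
    using finite_walk_ends[OF G(1) deg v] by (intro countable_UN) (auto intro: countable_finite)
  ultimately show ?thesis by (rule countable_subset)
qed

text \<open>A shortest walk visits exactly one vertex at each distance up to that of its end point.\<close>

lemma geodesic:
  assumes "(v, x) \<in> (adj_rel E)\<^sup>*"
  defines "D \<equiv> \<lambda>u. LEAST m. (v, u) \<in> adj_rel E ^^ m"
  shows "\<exists>r. r 0 = v \<and> r (D x) = x \<and> (\<forall>k\<le>D x. D (r k) = k) \<and> (\<forall>k<D x. {r k, r (Suc k)} \<in> E)"
proof -
  have walk: "(v, u) \<in> adj_rel E ^^ D u" if "(v, u) \<in> adj_rel E ^^ m" for u m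
    unfolding D_def using that by (rule LeastI)
  have le: "D u \<le> m" if "(v, u) \<in> adj_rel E ^^ m" for u m
    unfolding D_def using that by (rule Least_le)
  have "\<exists>r. r 0 = v \<and> r m = x \<and> (\<forall>k\<le>m. D (r k) = k) \<and> (\<forall>k<m. {r k, r (Suc k)} \<in> E)"
    if "(v, x) \<in> adj_rel E ^^ m" "D x = m" for x m
    using that
  proof (induction m arbitrary: x)
    case 0
    then show ?case by (intro exI[of _ "\<lambda>_. v"]) auto
  next
    case (Suc m)
    then obtain y where y: "(v, y) \<in> adj_rel E ^^ m" "{y, x} \<in> E" by (auto simp: adj_rel_def)
    have "(v, x) \<in> adj_rel E ^^ Suc (D y)" using walk[OF y(1)] y(2) by (auto simp: adj_rel_def)
    then have "D y = m" using le[OF y(1)] le Suc.prems(2) by fastforce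
    from Suc.IH[OF y(1) this] obtain r where
      r: "r 0 = v" "r m = y" "\<forall>k\<le>m. D (r k) = k" "\<forall>k<m. {r k, r (Suc k)} \<in> E" by blast
    show ?case
      using r y Suc.prems(2)
      by (intro exI[of _ "r(Suc m := x)"]) (auto simp: le_Suc_eq less_Suc_eq)
  qed
  moreover obtain m where "(v, x) \<in> adj_rel E ^^ m" using assms(1) by (auto simp: rtrancl_power)
  ultimately show ?thesis using walk by blast
qed

text \<open>Only finitely many vertices have distance less than \<open>n\<close> from \<open>v\<close>, so some vertex is farther away. A
  geodesic to it has distinct vertices, and after the first step it is too far from \<open>v\<close> to meet another
  neighbour of \<open>v\<close>.\<close>

lemma long_ray_avoiding_neighbors:
  assumes G: "simple_graph V E" "connected_graph V E" "infinite V"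
    and deg: "\<And>v. v \<in> V \<Longrightarrow> finite (neighbors E v)" and v: "v \<in> V" and n: "1 \<le> n"
  shows "\<exists>r. r 0 = v \<and> r 1 \<in> neighbors E v \<and> (\<forall>k\<le>n. r k \<in> V - (neighbors E v - {r 1})) \<and> inj_on r {..n} \<and>
    (\<forall>k<n. {r k, r (Suc k)} \<in> E)"
proof -
  define D where "D u = (LEAST m. (v, u) \<in> adj_rel E ^^ m)" for u
  have reach: "(v, u) \<in> (adj_rel E)\<^sup>*" if "u \<in> V" for u
    using G(2) v that by (auto simp: connected_graph_def)
  have "\<exists>x\<in>V. n \<le> D x"
  proof (rule ccontr)
    assume "\<not> (\<exists>x\<in>V. n \<le> D x)"
    then have "D x < n" if "x \<in> V" for x using that by auto
    moreover have "(v, x) \<in> adj_rel E ^^ D x" if "x \<in> V" for x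
      using reach[OF that] unfolding D_def rtrancl_power by (auto intro: LeastI)
    ultimately have "V \<subseteq> (\<Union>m\<in>{..<n}. {u. (v, u) \<in> adj_rel E ^^ m})" by blast
    moreover have "finite (\<Union>m\<in>{..<n}. {u. (v, u) \<in> adj_rel E ^^ m})"
      using finite_walk_ends[OF G(1) deg v] by blast
    ultimately show False using G(3) finite_subset by blast
  qed
  then obtain x where x: "x \<in> V" "n \<le> D x" by blast
  obtain r where r: "r 0 = v" "\<forall>k\<le>D x. D (r k) = k" "\<forall>k<D x. {r k, r (Suc k)} \<in> E"
    using geodesic[OF reach[OF x(1)]] unfolding D_def by blast
  have edge: "{r k, r (Suc k)} \<in> E" if "k < n" for k using r(3) x(2) that by auto
  have "inj_on r {..n}" using r(2) x(2) by (intro inj_on_inverseI[of _ D]) auto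
  moreover have "r 1 \<in> neighbors E v"
    using edge[of 0] n r(1) by (simp add: neighbors_def insert_commute)
  moreover have "r k \<in> V - (neighbors E v - {r 1})" if k: "k \<le> n" for k
  proof -
    have "r k \<in> V"
      using simple_graph_edge_verts[OF G(1) edge, of "k - 1"] k r(1) v by (cases k) auto
    moreover have "k \<le> 1" if "r k \<in> neighbors E v"
    proof -
      have "(v, r k) \<in> adj_rel E ^^ 1" using that by (simp add: neighbors_def adj_rel_def insert_commute)
      then have "D (r k) \<le> 1" unfolding D_def by (rule Least_le)
      then show ?thesis using r(2) k x(2) by auto
    qed
    moreover have "v \<notin> neighbors E v" using simple_graph_no_loop[OF G(1)] by (simp add: neighbors_def)
    ultimately show ?thesis using r(1) by (cases "k = 0"; cases "k = 1") auto
  qed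
  ultimately show ?thesis using r(1) edge by blast
qed

text \<open>A vertex is exposed if it has a neighbour outside \<open>H\<close>; connectedness provides one. Such a vertex has
  at most \<open>d - 1\<close> neighbours in \<open>H\<close>, and \<open>1/d * (1 - 1/d) ^ (d - 1)\<close> is the bound on \<open>p\<close>. It is the
  maximum of \<open>(1 - \<rho>) * \<rho> ^ (d - 1)\<close>, which is why \<open>\<rho> = 1 - 1/d\<close> is used.\<close>

lemma indep_poly_pos_bounded_degree:
  assumes G: "simple_graph V E" "connected_graph V E" "infinite V"
    and deg: "\<And>v. v \<in> V \<Longrightarrow> finite (neighbors E v)" "\<And>v. v \<in> V \<Longrightarrow> card (neighbors E v) \<le> d"
    and d: "2 \<le> d" and H: "finite H" "H \<subseteq> V"
  shows "0 < indep_poly E (real (d - 1) ^ (d - 1) / real d ^ d) H"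
proof (rule indep_poly_pos_if_exposed[where V = V and ex = "\<lambda>H v. \<exists>u. {u, v} \<in> E \<and> u \<notin> H"
      and \<rho> = "\<lambda>_. 1 - 1 / real d"])
  show "{v} \<notin> E" for v using simple_graph_no_loop[OF G(1)] .
next
  fix H :: "'a set" and u v assume "v \<in> H" "{u, v} \<in> E"
  then show "\<exists>w. {w, u} \<in> E \<and> w \<notin> H - {v}" by (auto intro!: exI[of _ v] simp: insert_commute)
next
  fix H assume H: "finite H" "H \<subseteq> V" "H \<noteq> {}"
  obtain h where h: "h \<in> H" using H by auto
  have "\<exists>x. x \<in> V - H" using G(3) H by (metis finite_subset Diff_iff subsetI)
  then obtain x where x: "x \<in> V" "x \<notin> H" by blast
  show "\<exists>v\<in>H. \<exists>u. {u, v} \<in> E \<and> u \<notin> H"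
  proof (rule ccontr)
    assume closed: "\<not> ?thesis"
    have "(h, x) \<in> (adj_rel E)\<^sup>*" using G(2) h H(2) x by (auto simp: connected_graph_def)
    then have "x \<in> H"
      by (induction rule: rtrancl_induct) (use h closed in \<open>auto simp: adj_rel_def insert_commute\<close>)
    with x show False by simp
  qed
next
  fix H v assume H: "finite H" "H \<subseteq> V" "v \<in> H" "\<exists>u. {u, v} \<in> E \<and> u \<notin> H"
  then obtain u where u: "u \<in> neighbors E v" "u \<notin> H" by (auto simp: neighbors_def)
  have "card (neighbors E v \<inter> H) < card (neighbors E v)"
    using u deg(1)[of v] H by (intro psubset_card_mono) auto
  then have k: "card (neighbors E v \<inter> H) \<le> d - 1" using deg(2)[of v] H by auto
  obtain m where m: "d = Suc m" using d by (cases d) auto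
  have "real (d - 1) ^ (d - 1) / real d ^ d = 1 / real d * (1 - 1 / real d) ^ (d - 1)"
    unfolding m by (simp add: power_divide field_simps)
  also have "\<dots> \<le> 1 / real d * (1 - 1 / real d) ^ card (neighbors E v \<inter> H)"
    using k d by (intro mult_left_mono power_decreasing) auto
  finally show "real (d - 1) ^ (d - 1) / real d ^ d \<le>
      (1 - (1 - 1 / real d)) * (\<Prod>u\<in>neighbors E v \<inter> H. 1 - 1 / real d)" by simp
qed (use d H in \<open>auto simp: field_simps\<close>)

section \<open>Stars with one long ray\<close>

abbreviation long_star_verts :: "nat \<Rightarrow> nat \<Rightarrow> star_vertex set" where
  "long_star_verts d n \<equiv> star_verts d (long_ray d n)"

abbreviation long_star_edges :: "nat \<Rightarrow> nat \<Rightarrow> star_vertex set set" where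
  "long_star_edges d n \<equiv> star_edges d (long_ray d n)"

lemma countable_star_verts: "countable (star_verts d n)"
proof -
  have "star_verts d n \<subseteq> insert Center (\<Union>i\<in>{1..d}. Ray i ` {1..n i})"
    unfolding star_verts_def by auto
  then show ?thesis by (meson countable_finite finite.simps finite_UN finite_atLeastAtMost finite_imageI finite_subset)
qed

lemma star_edges_no_loop: "{v} \<notin> star_edges d n"
  unfolding star_edges_def by (auto simp: insert_eq_iff)

text \<open>Parents for the star rooted at the far end of the long ray. The tip of the long ray gets as parent
  the vertex that would come next, so that its parent is always missing.\<close>

fun star_parent :: "nat \<Rightarrow> star_vertex \<Rightarrow> star_vertex" where
  "star_parent d Center = Ray d 1"
| "star_parent d (Ray i j) = (if i = d then Ray d (Suc j) else Center)"

text \<open>Ranks strictly increase towards the root, so the parent of a vertex of largest rank in a finite set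
  lies outside that set.\<close>

fun star_rank :: "nat \<Rightarrow> star_vertex \<Rightarrow> nat" where
  "star_rank d Center = 1"
| "star_rank d (Ray i j) = (if i = d then Suc j else 0)"

lemma star_rank_parent: "star_rank d v < star_rank d (star_parent d v)"
  by (cases v) auto

lemma long_star_edge_parent:
  assumes "{u, v} \<in> long_star_edges d n"
  shows "u = star_parent d v \<or> v = star_parent d u"
proof -
  consider i where "{u, v} = {Center, Ray i 1}"
    | i j where "1 \<le> j" "j + 1 \<le> long_ray d n i" "{u, v} = {Ray i j, Ray i (j + 1)}"
    using assms unfolding star_edges_def by blast
  then show ?thesis
  proof cases
    case 1
    then show ?thesis by (auto simp: doubleton_eq_iff split: if_splits)
  next
    case 2
    then have "i = d" by (auto simp: long_ray_def split: if_splits)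
    with 2 show ?thesis by (auto simp: doubleton_eq_iff)
  qed
qed

text \<open>This is \<open>(1 - p) ^ (d - 1) * \<lambda>\<close> with \<open>\<lambda>\<close> the larger root of \<open>x\<^sup>2 - x + p\<close>.\<close>

definition critical_fun :: "nat \<Rightarrow> real \<Rightarrow> real" where
  "critical_fun d p = 1/2 * (1 - p) ^ (d - 1) * (1 + sqrt (1 - 4 * p))"

lemma critical_fun_antimono:
  assumes "0 \<le> p" "p \<le> q" "q \<le> 1/4"
  shows "critical_fun d q \<le> critical_fun d p"
  unfolding critical_fun_def using assms
  by (intro mult_mono power_mono add_left_mono real_sqrt_le_mono) auto

text \<open>A vertex is exposed if its parent is missing, so its neighbours in \<open>H\<close> are children. Short rays get
  the ratio \<open>1 - p\<close>, exact for a single vertex. The centre and the vertices of the long ray get the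
  smaller root \<open>\<mu>\<close> of \<open>x\<^sup>2 - x + p\<close>: it is a fixed point of \<open>x \<mapsto> 1 - p / x\<close>, so the bound is
  inherited from each vertex of the long ray to the next one. At the centre, with \<open>d - 1\<close> leaves, the
  condition on the ratio is precisely \<open>p \<le> critical_fun d p\<close>.\<close>

lemma indep_poly_pos_long_star:
  assumes d: "1 \<le> d" and p: "0 < p" "p \<le> 1/4" "p \<le> critical_fun d p"
    and H: "finite H" "H \<subseteq> long_star_verts d n"
  shows "0 < indep_poly (long_star_edges d n) p H"
proof -
  define \<mu> where "\<mu> = (1 - sqrt (1 - 4 * p)) / 2"
  have sqrt: "sqrt (1 - 4 * p) < 1" "0 \<le> sqrt (1 - 4 * p)" using p by auto
  have \<mu>: "0 < \<mu>" using sqrt(1) by (simp add: \<mu>_def)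
  have "(1 - r) / 2 \<le> 1" if "0 \<le> r" for r :: real using that by simp
  then have \<mu>1: "\<mu> \<le> 1" using sqrt(2) unfolding \<mu>_def by blast
  have \<mu>_fix: "(1 - \<mu>) * \<mu> = p"
  proof -
    have "(1 - \<mu>) * \<mu> = (1 - (sqrt (1 - 4 * p))\<^sup>2) / 4"
      by (simp add: \<mu>_def power2_eq_square field_simps)
    then show ?thesis using p by simp
  qed
  have crit: "p \<le> (1 - \<mu>) * (1 - p) ^ (d - 1)"
    using p(3) by (simp add: critical_fun_def \<mu>_def field_simps)
  define \<rho> where "\<rho> v = (case v of Center \<Rightarrow> \<mu> | Ray i j \<Rightarrow> if i = d then \<mu> else 1 - p)" for v
  show ?thesis
  proof (rule indep_poly_pos_if_exposed[where V = "long_star_verts d n"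
        and ex = "\<lambda>H v. star_parent d v \<notin> H" and \<rho> = \<rho>])
    show "{v} \<notin> long_star_edges d n" for v by (rule star_edges_no_loop)
    show "0 < \<rho> v" "\<rho> v \<le> 1" for v using \<mu> \<mu>1 p by (auto simp: \<rho>_def split: star_vertex.split)
  next
    fix H u v assume "star_parent d v \<notin> H" "v \<in> H" "u \<in> H" "{u, v} \<in> long_star_edges d n"
    then show "star_parent d u \<notin> H - {v}" using long_star_edge_parent[of u v d n] by auto
  next
    fix H :: "star_vertex set"
    assume H: "finite H" "H \<noteq> {}"
    have "Max (star_rank d ` H) \<in> star_rank d ` H" using H by simp
    then obtain v where v: "v \<in> H" "star_rank d v = Max (star_rank d ` H)" by force
    have "star_parent d v \<notin> H"
    proof
      assume "star_parent d v \<in> H"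
      then have "star_rank d (star_parent d v) \<le> star_rank d v" using H v(2) by simp
      then show False using star_rank_parent[of d v] by simp
    qed
    with v(1) show "\<exists>v\<in>H. star_parent d v \<notin> H" by blast
  next
    fix H v assume H: "finite H" "H \<subseteq> long_star_verts d n" "v \<in> H" "star_parent d v \<notin> H"
    let ?N = "neighbors (long_star_edges d n) v \<inter> H"
    have N: "u \<in> H \<and> star_parent d u = v" if "u \<in> ?N" for u
      using that H(4) long_star_edge_parent[of u v d n] by (auto simp: neighbors_def)
    have leaf: "j = 1 \<and> 1 \<le> i \<and> i < d" if "Ray i j \<in> H" "i \<noteq> d" for i j
      using H(2) that by (auto simp: star_verts_def long_ray_def)
    show "p \<le> (1 - \<rho> v) * (\<Prod>u\<in>?N. \<rho> u)"
    proof (cases v)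
      case Center
      have sub: "?N \<subseteq> (\<lambda>i. Ray i 1) ` {1..<d}"
      proof
        fix u assume "u \<in> ?N"
        then have "u \<in> H" "star_parent d u = Center" using N Center by auto
        then obtain i j where u: "u = Ray i j" "i \<noteq> d" by (cases u) (auto split: if_splits)
        with leaf[of i j] \<open>u \<in> H\<close> have "j = 1" "i \<in> {1..<d}" by auto
        with u show "u \<in> (\<lambda>i. Ray i 1) ` {1..<d}" by blast
      qed
      have "card ?N \<le> card ((\<lambda>i. Ray i 1) ` {1..<d})" by (intro card_mono sub) auto
      also have "\<dots> \<le> d - 1" using card_image_le[of "{1..<d}" "\<lambda>i. Ray i 1"] by simp
      finally have k: "card ?N \<le> d - 1" .
      have "(\<Prod>u\<in>?N. \<rho> u) = (\<Prod>u\<in>?N. 1 - p)"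
        using sub by (intro prod.cong) (auto simp: \<rho>_def)
      also have "\<dots> = (1 - p) ^ card ?N" by simp
      also have "\<dots> \<ge> (1 - p) ^ (d - 1)" using k p by (intro power_decreasing) auto
      finally have "(1 - \<mu>) * (1 - p) ^ (d - 1) \<le> (1 - \<mu>) * (\<Prod>u\<in>?N. \<rho> u)"
        using \<mu>1 by (intro mult_left_mono) auto
      moreover have "\<rho> v = \<mu>" by (simp add: \<rho>_def Center)
      ultimately show ?thesis using crit by simp
    next
      case (Ray i j)
      show ?thesis
      proof (cases "i = d")
        case False
        have "?N = {}"
        proof (rule equals0I)
          fix u assume "u \<in> ?N"
          then have "star_parent d u = Ray i j" using N Ray by auto
          then show False using False by (cases u) (auto split: if_splits)
        qed
        moreover have "\<rho> v = 1 - p" using Ray False by (simp add: \<rho>_def)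
        ultimately show ?thesis by simp
      next
        case True
        define x where "x = (if j = 1 then Center else Ray d (j - 1))"
        have sub: "?N \<subseteq> {x}"
        proof
          fix u assume "u \<in> ?N"
          then have u: "u \<in> H" "star_parent d u = Ray d j" using N Ray True by auto
          show "u \<in> {x}"
          proof (cases u)
            case (Ray i' j')
            then have "i' = d" "j = Suc j'" using u(2) by (auto split: if_splits)
            moreover have "1 \<le> j'" using u(1) H(2) Ray by (auto simp: star_verts_def)
            ultimately show ?thesis using Ray by (simp add: x_def)
          qed (use u in \<open>simp add: x_def\<close>)
        qed
        have "\<mu> \<le> (\<Prod>u\<in>?N. \<rho> u)"
        proof (cases "?N = {}")
          case False
          then have "?N = {x}" using sub by blast
          then show ?thesis by (simp add: \<rho>_def x_def)
        qed (use \<mu>1 in simp)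
        then have "(1 - \<mu>) * \<mu> \<le> (1 - \<mu>) * (\<Prod>u\<in>?N. \<rho> u)"
          using \<mu>1 by (intro mult_left_mono) auto
        moreover have "\<rho> v = \<mu>" using Ray True by (simp add: \<rho>_def)
        ultimately show ?thesis using \<mu>_fix by simp
      qed
    qed
  qed (use p H in auto)
qed

section \<open>The limiting threshold\<close>

text \<open>If \<open>q > 1/4\<close>, the quadratic has no real root and minimum \<open>q - 1/4\<close>. Otherwise
  \<open>critical_fun d q < q\<close> says that \<open>\<sigma> = 1 - q / (1 - q) ^ (d - 1)\<close> is less than the smaller root \<open>\<mu>\<close>,
  and on \<open>s \<le> \<sigma>\<close> both factors \<open>\<mu> - s\<close> and \<open>(1 - \<mu>) - s\<close> are at least \<open>\<mu> - \<sigma>\<close>.\<close>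

lemma ratio_decrement:
  assumes q: "0 < q" and super: "1/4 < q \<or> critical_fun d q < q"
  shows "\<exists>\<epsilon>>0. \<forall>s. 0 < s \<longrightarrow> s \<le> 1 - q / (1 - q) ^ (d - 1) \<longrightarrow> \<epsilon> \<le> s\<^sup>2 - s + q"
proof (cases "1/4 < q")
  case True
  have "q - 1/4 \<le> s\<^sup>2 - s + q" for s :: real
    using zero_le_power2[of "s - 1/2"] by (simp add: power2_eq_square algebra_simps)
  then show ?thesis using True by (intro exI[of _ "q - 1/4"]) auto
next
  case False
  then have crit: "critical_fun d q < q" and q4: "q \<le> 1/4" using super by auto
  define \<mu> \<sigma> where "\<mu> = (1 - sqrt (1 - 4 * q)) / 2" and "\<sigma> = 1 - q / (1 - q) ^ (d - 1)"
  have "0 < (1 - q) ^ (d - 1)" using q4 by simp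
  moreover have "(1 - \<mu>) * (1 - q) ^ (d - 1) < q"
    using crit by (simp add: critical_fun_def \<mu>_def field_simps)
  ultimately have "1 - \<mu> < q / (1 - q) ^ (d - 1)" by (simp add: less_divide_eq)
  then have \<sigma>: "\<sigma> < \<mu>" by (simp add: \<sigma>_def)
  have "0 \<le> sqrt (1 - 4 * q)" using q4 by simp
  then have \<mu>: "\<mu> \<le> 1 - \<mu>" by (simp add: \<mu>_def field_simps)
  have "\<mu> * (1 - \<mu>) = (1 - (sqrt (1 - 4 * q))\<^sup>2) / 4"
    by (simp add: \<mu>_def power2_eq_square field_simps)
  then have prod: "\<mu> * (1 - \<mu>) = q" using q4 by simp
  have "(\<mu> - \<sigma>)\<^sup>2 \<le> s\<^sup>2 - s + q" if "s \<le> \<sigma>" for s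
  proof -
    have "(\<mu> - \<sigma>)\<^sup>2 \<le> (\<mu> - s) * (1 - \<mu> - s)"
      unfolding power2_eq_square using that \<sigma> \<mu> by (intro mult_mono) auto
    also have "\<dots> = s\<^sup>2 - s + \<mu> * (1 - \<mu>)" by (simp add: power2_eq_square algebra_simps)
    finally show ?thesis unfolding prod .
  qed
  then show ?thesis using \<sigma> by (intro exI[of _ "(\<mu> - \<sigma>)\<^sup>2"]) (auto simp: \<sigma>_def)
qed

text \<open>The star is a subgraph that need not be induced: there may be further edges among the vertices of
  \<open>L\<close> and of the path.\<close>

definition contains_long_star :: "nat \<Rightarrow> nat \<Rightarrow> 'a set \<Rightarrow> 'a set set \<Rightarrow> bool" where
  "contains_long_star d n V E \<longleftrightarrow> (\<exists>L r. finite L \<and> card L = d - 1 \<and> L \<subseteq> V \<and>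
     (\<forall>u\<in>L. {u, r 0} \<in> E) \<and> (\<forall>k\<le>n. r k \<in> V - L) \<and> inj_on r {..n} \<and>
     (\<forall>k<n. {r k, r (Suc k)} \<in> E))"

text \<open>The length \<open>N\<close> depends only on \<open>q\<close> and \<open>d\<close>, not on the graph, so the same lemma applies to the
  sequence of stars and to a fixed infinite graph.\<close>

lemma p_h_le_if_contains_long_star:
  assumes q: "0 < q" "1/4 < q \<or> critical_fun d q < q"
  shows "\<exists>N\<ge>1. \<forall>n\<ge>N. \<forall>(V :: 'a set) E. countable V \<longrightarrow> (\<forall>v. {v} \<notin> E) \<longrightarrow>
     contains_long_star d n V E \<longrightarrow> p_h V E \<le> q"
proof -
  obtain \<epsilon> where \<epsilon>: "0 < \<epsilon>" "\<And>s. 0 < s \<Longrightarrow> s \<le> 1 - q / (1 - q) ^ (d - 1) \<Longrightarrow> \<epsilon> \<le> s\<^sup>2 - s + q"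
    using ratio_decrement[OF assms] by blast
  obtain N :: nat where N: "1 / \<epsilon> < real N" using reals_Archimedean2 by blast
  have "0 < 1 / \<epsilon>" using \<epsilon>(1) by simp
  then have N1: "1 \<le> N" using N by linarith
  show ?thesis
  proof (intro exI[of _ N] conjI N1 allI impI)
    fix n and V :: "'a set" and E :: "'a set set"
    assume n: "N \<le> n" and V: "countable V" and loop: "\<forall>v. {v} \<notin> E"
    assume "contains_long_star d n V E"
    then obtain L and r :: "nat \<Rightarrow> 'a" where L: "finite L" "card L = d - 1" "L \<subseteq> V" "\<forall>u\<in>L. {u, r 0} \<in> E"
      and r: "\<forall>k\<le>n. r k \<in> V - L" "inj_on r {..n}" "\<forall>k<n. {r k, r (Suc k)} \<in> E"
      unfolding contains_long_star_def by blast
    have "1 / \<epsilon> < real n" using N n by linarith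
    then have n\<epsilon>: "1 < real n * \<epsilon>" using \<epsilon>(1) by (simp add: divide_less_eq)
    have "\<not> (\<forall>H. finite H \<and> H \<subseteq> V \<longrightarrow> 0 < indep_poly E q H)"
    proof
      assume pos: "\<forall>H. finite H \<and> H \<subseteq> V \<longrightarrow> 0 < indep_poly E q H"
      have "real n * \<epsilon> < 1"
      proof (rule long_ray_bound[OF _ q(1) pos L(1,3) _ _ r(2) _ \<epsilon>(1)])
        show "\<epsilon> \<le> s\<^sup>2 - s + q" if "0 < s" "s \<le> 1 - q / (1 - q) ^ card L" for s
          using \<epsilon>(2) that unfolding L(2) .
      qed (use loop L r in auto)
      with n\<epsilon> show False by simp
    qed
    then show "p_h V E \<le> q" using p_h_le[OF V] loop q(1) by simp
  qed
qed

text \<open>The largest \<open>p \<le> 1/4\<close> with \<open>p \<le> critical_fun d p\<close>: either the cut-off \<open>1/4\<close> or a fixed point is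
  reached. It is shown below to be the limit of the critical points of the stars.\<close>

definition star_threshold :: "nat \<Rightarrow> real \<Rightarrow> bool" where
  "star_threshold d c \<longleftrightarrow> 0 < c \<and> c \<le> 1/4 \<and> c \<le> critical_fun d c \<and> (c = 1/4 \<or> critical_fun d c = c)"

lemma supercritical_above_threshold:
  assumes "star_threshold d c" "c < q"
  shows "0 < q \<and> (1/4 < q \<or> critical_fun d q < q)"
  using assms critical_fun_antimono[of c q d] unfolding star_threshold_def by force

lemma p_h_star_ge:
  assumes "star_threshold d c" "1 \<le> d"
  shows "c \<le> p_h_star d n"
  unfolding p_h_star_def
proof (rule p_h_ge)
  show "\<forall>H. finite H \<and> H \<subseteq> long_star_verts d n \<longrightarrow> 0 \<le> indep_poly (long_star_edges d n) c H"
    using indep_poly_pos_long_star[of d c _ n] assms unfolding star_threshold_def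
    by (auto intro: less_imp_le)
  show "long_star_verts d n \<noteq> {}" by (auto simp: star_verts_def)
  show "0 \<le> c" using assms(1) by (simp add: star_threshold_def)
qed (rule countable_star_verts star_edges_no_loop)+

lemma p_h_star_eventually_le:
  assumes "star_threshold d c" "c < q" "2 \<le> d"
  shows "eventually (\<lambda>n. p_h_star d n \<le> q) sequentially"
proof -
  obtain N where N: "1 \<le> N" "\<forall>n\<ge>N. \<forall>(V :: star_vertex set) E. countable V \<longrightarrow> (\<forall>v. {v} \<notin> E) \<longrightarrow>
     contains_long_star d n V E \<longrightarrow> p_h V E \<le> q"
    using p_h_le_if_contains_long_star[of q d] supercritical_above_threshold[OF assms(1,2)] by blast
  have "p_h_star d n \<le> q" if n: "N \<le> n" for n
  proof -
    let ?r = "\<lambda>k. if k = 0 then Center else Ray d k" and ?L = "(\<lambda>i. Ray i 1) ` {1..<d}"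
    have "card ?L = d - 1" by (subst card_image) (auto intro!: inj_onI)
    moreover have "?L \<subseteq> long_star_verts d n" by (auto simp: star_verts_def long_ray_def)
    moreover have "\<forall>u\<in>?L. {u, ?r 0} \<in> long_star_edges d n"
      by (auto simp: star_edges_def insert_commute)
    moreover have "\<forall>k\<le>n. ?r k \<in> long_star_verts d n - ?L"
      using assms(3) by (auto simp: star_verts_def long_ray_def)
    moreover have "inj_on ?r {..n}" by (auto intro!: inj_onI split: if_splits)
    moreover have "{?r k, ?r (Suc k)} \<in> long_star_edges d n" if "k < n" for k
    proof (cases "k = 0")
      case True
      then show ?thesis using assms(3) by (auto simp: star_edges_def)
    next
      case False
      then have "1 \<le> d \<and> d \<le> d \<and> 1 \<le> k \<and> k + 1 \<le> long_ray d n d \<and> {Ray d k, Ray d (Suc k)} = {Ray d k, Ray d (k + 1)}"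
        using assms(3) that by (simp add: long_ray_def)
      then show ?thesis using False unfolding star_edges_def by auto
    qed
    ultimately have "contains_long_star d n (long_star_verts d n) (long_star_edges d n)"
      unfolding contains_long_star_def by (intro exI[of _ ?L] exI[of _ ?r] conjI) auto
    then show ?thesis
      unfolding p_h_star_def
      by (intro N(2)[rule_format, OF n] countable_star_verts star_edges_no_loop)
  qed
  then show ?thesis by (auto simp: eventually_sequentially)
qed

lemma p_h_star_tendsto:
  assumes "star_threshold d c" "2 \<le> d"
  shows "p_h_star d \<longlonglongrightarrow> c"
proof (rule order_tendstoI)
  fix a assume "a < c"
  then show "eventually (\<lambda>n. a < p_h_star d n) sequentially"
    using p_h_star_ge[OF assms(1)] assms(2) by (intro always_eventually) (auto intro: less_le_trans)
next
  fix a assume "c < a"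
  then obtain q where q: "c < q" "q < a" using dense by blast
  show "eventually (\<lambda>n. p_h_star d n < a) sequentially"
    using p_h_star_eventually_le[OF assms(1) q(1) assms(2)] q(2) by (auto elim: eventually_mono)
qed

lemma p_h_le_threshold:
  fixes V :: "'a set"
  assumes c: "star_threshold d c" and d: "2 \<le> d"
    and G: "simple_graph V E" "connected_graph V E" "infinite V" "has_max_degree V E d"
  shows "p_h V E \<le> c"
proof (rule dense_ge)
  fix q assume q: "c < q"
  obtain N where N: "1 \<le> N" "\<forall>n\<ge>N. \<forall>(V :: 'a set) E. countable V \<longrightarrow> (\<forall>v. {v} \<notin> E) \<longrightarrow>
     contains_long_star d n V E \<longrightarrow> p_h V E \<le> q"
    using p_h_le_if_contains_long_star[of q d] supercritical_above_threshold[OF c q] by blast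
  have deg: "finite (neighbors E v)" if "v \<in> V" for v using G(4) that by (simp add: has_max_degree_def)
  obtain v where v: "v \<in> V" "card (neighbors E v) = d" using G(4) by (auto simp: has_max_degree_def)
  obtain r where r: "r 0 = v" "r 1 \<in> neighbors E v" "\<forall>k\<le>N. r k \<in> V - (neighbors E v - {r 1})"
    "inj_on r {..N}" "\<forall>k<N. {r k, r (Suc k)} \<in> E"
    using long_ray_avoiding_neighbors[OF G(1-3) deg v(1) N(1)] by blast
  let ?L = "neighbors E v - {r 1}"
  have "card ?L = d - 1" using r(2) v(2) by (simp add: card_Diff_singleton)
  moreover have "?L \<subseteq> V" using simple_graph_edge_verts[OF G(1)] by (auto simp: neighbors_def)
  moreover have "\<forall>u\<in>?L. {u, r 0} \<in> E" using r(1) by (auto simp: neighbors_def)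
  ultimately have "contains_long_star d N V E"
    unfolding contains_long_star_def using deg[OF v(1)] r(3-5)
    by (intro exI[of _ ?L] exI[of _ r] conjI) auto
  then show "p_h V E \<le> q"
    using N(2) countable_verts[OF G(1,2) deg] simple_graph_no_loop[OF G(1)] by blast
qed

section \<open>Values of the threshold\<close>

text \<open>At \<open>p = 1/4\<close> the square root vanishes, and \<open>critical_fun\<close> takes the values \<open>3/8\<close> and \<open>9/32\<close>.\<close>

lemma star_threshold_small_degree:
  assumes "d = 2 \<or> d = 3"
  shows "star_threshold d (1/4)"
  using assms by (auto simp: star_threshold_def critical_fun_def power2_eq_square)

lemma critical_fun_quarter_less:
  assumes "4 \<le> d"
  shows "critical_fun d (1/4) < 1/4"
proof -
  have "(3/4 :: real) ^ (d - 1) \<le> (3/4) ^ 3" using assms by (intro power_decreasing) auto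
  also have "\<dots> < 1/2" by (simp add: power3_eq_cube)
  finally show ?thesis by (simp add: critical_fun_def)
qed

lemma star_threshold_iff_root:
  assumes "4 \<le> d"
  shows "star_threshold d p \<longleftrightarrow> 0 < p \<and> p \<le> 1/4 \<and> critical_fun d p = p"
proof -
  have "p \<noteq> 1/4" if "p \<le> critical_fun d p"
    using that critical_fun_quarter_less[OF assms] by (metis not_le)
  then show ?thesis unfolding star_threshold_def by auto
qed

text \<open>For \<open>d \<ge> 4\<close> the difference \<open>critical_fun d p - p\<close> changes sign between \<open>0\<close> and \<open>1/4\<close>.\<close>

lemma star_threshold_exists:
  assumes "2 \<le> d"
  shows "\<exists>c. star_threshold d c"
proof (cases "d = 2 \<or> d = 3")
  case False
  then have d: "4 \<le> d" using assms by auto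
  have "critical_fun d (1/4) - 1/4 \<le> 0" using critical_fun_quarter_less[OF d] by simp
  moreover have "0 \<le> critical_fun d 0 - 0" by (simp add: critical_fun_def)
  moreover have "continuous_on {0..1/4} (\<lambda>p. critical_fun d p - p)"
    unfolding critical_fun_def by (intro continuous_intros)
  ultimately obtain p where p: "0 \<le> p" "p \<le> 1/4" "critical_fun d p - p = 0"
    using IVT2'[of "\<lambda>p. critical_fun d p - p" "1/4" 0 0] by auto
  moreover have "p \<noteq> 0" using p(3) by (auto simp: critical_fun_def)
  ultimately show ?thesis using star_threshold_iff_root[OF d] by force
qed (use star_threshold_small_degree in blast)

theorem corollary1p3:
  shows "(\<forall>d\<ge>2. convergent (p_h_star d)) \<and>
    (\<forall>d\<ge>2. \<forall>(V :: 'a set) E.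
        simple_graph V E \<and> infinite V \<and> connected_graph V E \<and> has_max_degree V E d \<longrightarrow>
        real (d - 1) ^ (d - 1) / real d ^ d \<le> p_h V E \<and> p_h V E \<le> p_star d) \<and>
    p_star 2 = 1/4 \<and> p_star 3 = 1/4 \<and>
    (\<forall>d\<ge>4. \<forall>p::real.
        (0 < p \<and> p \<le> 1/4 \<and> 1/2 * (1 - p) ^ (d - 1) * (1 + sqrt (1 - 4 * p)) = p)
        \<longleftrightarrow> p = p_star d)"
proof (intro conjI allI impI)
  have p_star: "p_star d = c" if "star_threshold d c" "2 \<le> d" for d c
    unfolding p_star_def using p_h_star_tendsto[OF that] by (rule limI)
  show "convergent (p_h_star d)" if "2 \<le> d" for d
    using star_threshold_exists[OF that] p_h_star_tendsto that by (auto simp: convergent_def)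
  show "p_star 2 = 1/4" "p_star 3 = 1/4"
    by (rule p_star[OF star_threshold_small_degree]; simp)+
  have thr: "star_threshold d (p_star d)" if "2 \<le> d" for d
    using star_threshold_exists[OF that] p_star[OF _ that] by force
  show "(0 < p \<and> p \<le> 1/4 \<and> 1/2 * (1 - p) ^ (d - 1) * (1 + sqrt (1 - 4 * p)) = p) \<longleftrightarrow> p = p_star d"
    if "4 \<le> d" for d p
  proof -
    have d: "2 \<le> d" using that by simp
    have "p_star d = p" if "star_threshold d p" by (rule p_star[OF that d])
    then show ?thesis
      using thr[OF d] unfolding star_threshold_iff_root[OF \<open>4 \<le> d\<close>] critical_fun_def by blast
  qed
  fix d :: nat and V :: "'a set" and E
  assume d: "2 \<le> d" and G: "simple_graph V E \<and> infinite V \<and> connected_graph V E \<and> has_max_degree V E d"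
  show "p_h V E \<le> p_star d" using p_h_le_threshold[OF thr[OF d] d] G by blast
  have deg: "finite (neighbors E v)" "card (neighbors E v) \<le> d" if "v \<in> V" for v
    using G that by (auto simp: has_max_degree_def)
  show "real (d - 1) ^ (d - 1) / real d ^ d \<le> p_h V E"
  proof (rule p_h_ge)
    show "countable V" using countable_verts G deg by blast
    show "V \<noteq> {}" using G by auto
    show "{v} \<notin> E" for v by (rule simple_graph_no_loop) (use G in blast)
    have "0 < indep_poly E (real (d - 1) ^ (d - 1) / real d ^ d) H" if "finite H" "H \<subseteq> V" for H
      by (rule indep_poly_pos_bounded_degree[OF _ _ _ deg d that]) (use G in auto)
    then show "\<forall>H. finite H \<and> H \<subseteq> V \<longrightarrow> 0 \<le> indep_poly E (real (d - 1) ^ (d - 1) / real d ^ d) H"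
      by (blast intro: less_imp_le)
  qed simp
qed

end
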